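(* For every $d \ge 2$ there exists a constant $\gamma = \gamma(d) > 0$ such that for every positive integer $n$ there exists an $n$-point set $P \subset \mathbb{R}^d$ in general position with $\operatorname{diam}(P) \le 2\sqrt[d]{n}$ that contains no convex independent subset of size $\gamma n^{\frac{d-1}{d+1}}$.
   Context: For a finite set $P \subset \mathbb{R}^d$ with at least two points, $\operatorname{diam}(P) = \frac{\max\{|a-b| : a,b \in P, a \ne b\}}{\min\{|a-b| : a,b\in P, a \ne b\}}$ (Euclidean distances). A set is in general position if no $d+1$ of its points lie on a common affine hyperplane. A set $Q$ is convex independent if $Q$ is in general position and its points are the vertices of a convex polytope. *)

theory Defs
  imports "HOL-Analysis.Analysis"
begin

text \<open>The ratio of the largest to the smallest distance, not to be confused with the library's
  \<^term>\<open>diameter\<close>. It is meaningful only for finite sets with at least two points;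
  otherwise \<^term>\<open>Max\<close> and \<^term>\<open>Min\<close> are unspecified.\<close>

definition diam :: "'a::metric_space set \<Rightarrow> real" where
  "diam P = Max {dist a b | a b. a \<in> P \<and> b \<in> P \<and> a \<noteq> b} /
            Min {dist a b | a b. a \<in> P \<and> b \<in> P \<and> a \<noteq> b}"

definition general_position :: "'a::euclidean_space set \<Rightarrow> bool" where
  "general_position P \<longleftrightarrow>
     \<not> (\<exists>S a b. S \<subseteq> P \<and> card S = DIM('a) + 1 \<and> a \<noteq> 0 \<and> S \<subseteq> {x. a \<bullet> x = b})"

definition convex_independent :: "'a::euclidean_space set \<Rightarrow> bool" where
  "convex_independent Q \<longleftrightarrow>
     general_position Q \<and> (\<exists>K. polytope K \<and> Q = {v. v extreme_point_of K})"

end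

theory Submission
  imports Defs
begin

text \<open>Rescale to the unit ball and put \<open>r = n powr (- 1 / d)\<close>. The points are chosen one after the other,
  at distance at least \<open>r\<close> from each other, so that the ratio of distances is at most \<open>2 / r\<close>.

  \<^emph>\<open>Counting convex surfaces.\<close> The boundary of a convex body in the unit ball splits into \<open>2 d\<close> graphs of
  convex functions with slopes at most \<open>1\<close>. Rounding the values of such a function on a grid of mesh
  \<open>1 / M\<close> to multiples of \<open>1 / M\<^sup>2\<close> leaves only \<open>exp (O(M ^ (d - 1)))\<close> possibilities, because the second
  differences along a grid line are nonnegative and have a bounded sum. The rounded values determine the
  graph up to a thin shell of volume \<open>O(1 / M\<^sup>2)\<close>. Hence every convex independent set is covered by \<open>2 d\<close>
  members of a fixed family of \<open>exp (O(M ^ (d - 1)))\<close> thin shells.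

  \<^emph>\<open>Choosing the points.\<close> As long as the region allowed for the next point has volume at least \<open>v\<close>, a random
  point of it falls into a shell with probability \<open>O(1 / (v * M\<^sup>2))\<close>; the sum of \<open>2 ^ card (P \<inter> S)\<close> over all
  shells \<open>S\<close> serves to derandomize the choice. With \<open>M\<close> of order \<open>n powr (1 / (d + 1))\<close> every shell then receives
  \<open>O(n powr ((d - 1) / (d + 1)))\<close> points. The \<open>n\<close> forbidden balls of radius \<open>r\<close> have the same total volume as
  the unit ball, so to keep \<open>v\<close> constant a positive fraction of the points is first placed in pairs
  whose balls overlap.\<close>

section \<open>Convex functions with bounded slopes\<close>

text \<open>The condition \<open>s $ i = 0\<close>, imposed at every point, forces the function to
  be constant along axis \<open>i\<close>. Functions of the other coordinates are thus encoded as
  functions on the full space.\<close>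

definition subgradient :: "'d \<Rightarrow> (real ^ 'd \<Rightarrow> real) \<Rightarrow> real ^ 'd \<Rightarrow> real ^ 'd \<Rightarrow> bool"
  where "subgradient i f z s \<longleftrightarrow>
    s $ i = 0 \<and> (\<forall>j. \<bar>s $ j\<bar> \<le> 1) \<and> (\<forall>x. f x \<ge> f z + s \<bullet> (x - z))"

text \<open>A subgradient at every point amounts to convexity with slopes at most 1. The bound at
  the origin is the one that envelopes of points of the unit ball satisfy; it keeps the number of
  rounded functions finite.\<close>

definition tame :: "'d \<Rightarrow> (real ^ 'd \<Rightarrow> real) \<Rightarrow> bool"
  where "tame i f \<longleftrightarrow> (\<forall>z. \<exists>s. subgradient i f z s) \<and> \<bar>f 0\<bar> \<le> real CARD('d) + 1"

definition second_diff :: "(real ^ 'd \<Rightarrow> real) \<Rightarrow> real \<Rightarrow> real ^ 'd \<Rightarrow> 'd \<Rightarrow> real"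
  where "second_diff f h z j = f (z + h *\<^sub>R axis j 1) + f (z - h *\<^sub>R axis j 1) - 2 * f z"

lemma subgradientD:
  assumes "subgradient i f z s"
  shows "s $ i = 0" "\<bar>s $ j\<bar> \<le> 1" "f z + s \<bullet> (x - z) \<le> f x"
  using assms unfolding subgradient_def by auto

lemma inner_le_sum_abs:
  fixes s :: "real ^ 'd"
  assumes "\<And>j. \<bar>s $ j\<bar> \<le> 1"
  shows "\<bar>s \<bullet> x\<bar> \<le> (\<Sum>j\<in>UNIV. \<bar>x $ j\<bar>)"
proof -
  have "\<bar>s \<bullet> x\<bar> \<le> (\<Sum>j\<in>UNIV. \<bar>s $ j * x $ j\<bar>)"
    unfolding inner_vec_def by simp
  also have "\<dots> \<le> (\<Sum>j\<in>UNIV. \<bar>x $ j\<bar>)"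
    using assms by (intro sum_mono) (simp add: abs_mult mult_left_le_one_le)
  finally show ?thesis .
qed

lemma tame_lipschitz:
  fixes f :: "real ^ 'd \<Rightarrow> real"
  assumes "tame i f"
  shows "\<bar>f x - f y\<bar> \<le> (\<Sum>j\<in>UNIV. \<bar>x $ j - y $ j\<bar>)"
proof -
  have *: "f y - f x \<le> (\<Sum>j\<in>UNIV. \<bar>x $ j - y $ j\<bar>)" for x y
  proof -
    obtain s where s: "subgradient i f y s" using assms tame_def by blast
    have "f y + s \<bullet> (x - y) \<le> f x" using subgradientD(3)[OF s] .
    moreover have "\<bar>s \<bullet> (x - y)\<bar> \<le> (\<Sum>j\<in>UNIV. \<bar>(x - y) $ j\<bar>)"
      using inner_le_sum_abs subgradientD(2)[OF s] by blast
    ultimately show ?thesis by simp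
  qed
  show ?thesis using *[of x y] *[of y x] by (simp add: abs_minus_commute abs_le_iff)
qed

lemma tame_step:
  assumes "tame i f"
  shows "\<bar>f (x + t *\<^sub>R axis j 1) - f x\<bar> \<le> \<bar>t\<bar>"
proof -
  have "\<bar>f (x + t *\<^sub>R axis j 1) - f x\<bar> \<le> (\<Sum>k\<in>UNIV. \<bar>(x + t *\<^sub>R axis j 1) $ k - x $ k\<bar>)"
    using tame_lipschitz[OF assms] .
  also have "\<dots> = (\<Sum>k\<in>UNIV. if k = j then \<bar>t\<bar> else 0)"
    by (intro sum.cong) (auto simp: axis_def)
  finally show ?thesis by simp
qed

lemma subgradient_step:
  assumes "subgradient i f z s"
  shows "h * s $ j \<le> f (z + h *\<^sub>R axis j 1) - f z" "- h * s $ j \<le> f (z - h *\<^sub>R axis j 1) - f z"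
  using subgradientD(3)[OF assms, of "z + h *\<^sub>R axis j 1"] subgradientD(3)[OF assms, of "z - h *\<^sub>R axis j 1"]
  by (auto simp: inner_axis)

lemma tame_second_diff_nonneg:
  assumes "tame i f"
  shows "second_diff f h z j \<ge> 0"
proof -
  obtain s where "subgradient i f z s" using assms tame_def by blast
  from subgradient_step[OF this, of h j] show ?thesis unfolding second_diff_def by simp
qed

lemma inner_off_coordinate:
  fixes s :: "real ^ 'd"
  assumes "s $ i = 0"
  shows "s \<bullet> x = (\<Sum>j\<in>-{i}. s $ j * x $ j)"
  unfolding inner_vec_def inner_real_def using assms
  by (subst sum.mono_neutral_right[of UNIV "-{i}"]) auto

text \<open>Convexity: in the cross-polytope of radius \<open>h\<close> around \<open>z\<close>, the distance of \<open>f\<close> from its tangent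
  plane at \<open>z\<close> is controlled by the values at the vertices.\<close>

lemma tame_above_tangent:
  fixes f :: "real ^ 'd \<Rightarrow> real"
  assumes f: "tame i f" and s: "subgradient i f z s"
    and h: "h > 0" and x: "(\<Sum>j\<in>-{i}. \<bar>x $ j - z $ j\<bar>) \<le> h"
  shows "f x - (f z + s \<bullet> (x - z)) \<le> (\<Sum>j\<in>-{i}. second_diff f h z j)"
proof -
  obtain p where p: "subgradient i f x p" using f tame_def by blast
  define \<phi> where "\<phi> y = f y - f z - s \<bullet> (y - z)" for y
  \<comment> \<open>Apart from coordinate \<open>i\<close>, \<open>x\<close> is the combination of
    the vertices \<open>v j\<close> on its side of \<open>z\<close> with weights \<open>w j\<close>,
    the remaining weight being at \<open>z\<close> itself.\<close>
  define t where "t j = x $ j - z $ j" for j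
  define w where "w j = \<bar>t j\<bar> / h" for j
  define v where "v j = z + (if t j \<ge> 0 then h else - h) *\<^sub>R axis j (1::real)" for j
  define r where "r = p - s"
  have \<phi>0: "\<phi> y \<ge> 0" for y
    using subgradientD(3)[OF s, of y] by (simp add: \<phi>_def)
  have ri: "r $ i = 0" using subgradientD(1)[OF s] subgradientD(1)[OF p] by (simp add: r_def)
  have tan: "\<phi> y \<ge> \<phi> x + r \<bullet> (y - x)" for y
    using subgradientD(3)[OF p, of y] by (simp add: \<phi>_def r_def inner_diff_left inner_diff_right)
  define T where "T = r \<bullet> (x - z)"
  have T1: "\<phi> x \<le> T" using tan[of z]
    by (simp add: T_def \<phi>_def inner_diff_right)
  have T2: "T = (\<Sum>j\<in>-{i}. r $ j * t j)"
    unfolding T_def t_def by (subst inner_off_coordinate[OF ri]) simp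
  have vtx: "\<phi> (v j) \<ge> \<phi> x - T + (if t j \<ge> 0 then h else - h) * r $ j" for j
  proof -
    have "r \<bullet> (v j - x) = r \<bullet> (v j - z) - T" by (simp add: T_def inner_diff_right)
    also have "r \<bullet> (v j - z) = (if t j \<ge> 0 then h else - h) * r $ j"
      by (simp add: v_def inner_axis)
    finally show ?thesis using tan[of "v j"] by linarith
  qed
  have vtx2: "\<phi> (v j) \<le> second_diff f h z j" for j
  proof -
    have "\<phi> (z + h *\<^sub>R axis j 1) + \<phi> (z - h *\<^sub>R axis j 1) = second_diff f h z j"
      by (simp add: \<phi>_def second_diff_def)
    then show ?thesis
      using \<phi>0[of "z + h *\<^sub>R axis j 1"] \<phi>0[of "z - h *\<^sub>R axis j 1"] by (auto simp: v_def)
  qed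
  have w0: "w j \<ge> 0" for j using h by (simp add: w_def)
  have wsum: "(\<Sum>j\<in>-{i}. w j) \<le> 1"
    using x h unfolding w_def t_def by (simp add: sum_divide_distrib[symmetric])
  have w1: "w j \<le> 1" if "j \<noteq> i" for j
  proof -
    have "w j \<le> (\<Sum>j\<in>-{i}. w j)" using that w0 by (intro member_le_sum) auto
    then show ?thesis using wsum by simp
  qed
  have wt: "w j * ((if t j \<ge> 0 then h else - h) * r $ j) = r $ j * t j" for j
    using h by (simp add: w_def abs_if)
  have "\<phi> x - T \<le> (\<Sum>j\<in>-{i}. w j) * (\<phi> x - T)"
    using T1 wsum mult_right_mono_neg[of "\<Sum>j\<in>-{i}. w j" 1 "\<phi> x - T"] by simp
  then have "\<phi> x \<le> (\<Sum>j\<in>-{i}. w j) * (\<phi> x - T) + T" by simp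
  also have "\<dots> = (\<Sum>j\<in>-{i}. w j * (\<phi> x - T + (if t j \<ge> 0 then h else - h) * r $ j))"
    unfolding T2[symmetric] distrib_left sum.distrib wt by (simp add: sum_distrib_right T2)
  also have "\<dots> \<le> (\<Sum>j\<in>-{i}. w j * \<phi> (v j))"
    by (intro sum_mono mult_left_mono vtx w0)
  also have "\<dots> \<le> (\<Sum>j\<in>-{i}. second_diff f h z j)"
  proof (intro sum_mono)
    fix j assume j: "j \<in> -{i}"
    have "w j * \<phi> (v j) \<le> \<phi> (v j)" using w0[of j] w1[of j] j \<phi>0
      by (simp add: mult_left_le_one_le)
    then show "w j * \<phi> (v j) \<le> second_diff f h z j" using vtx2[of j] by simp
  qed
  finally show ?thesis by (simp add: \<phi>_def algebra_simps)
qed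

text \<open>Closeness at \<open>z\<close> and its neighbours bounds both the change of slope and the
  growth of the second differences when passing from \<open>f\<close> to \<open>g\<close>. As
  \<open>g\<close> lies between its own tangent plane and that plane raised by its second
  differences, it stays near the tangent plane of \<open>f\<close>, with an error that depends on
  \<open>f\<close> and \<open>e\<close> only.\<close>

lemma tame_near_tangent:
  fixes f g :: "real ^ 'd \<Rightarrow> real"
  assumes f: "tame i f" and g: "tame i g" and s: "subgradient i f z s"
    and h: "h > 0" and x: "(\<Sum>j\<in>-{i}. \<bar>x $ j - z $ j\<bar>) \<le> h" and e: "e \<ge> 0"
    and z0: "\<bar>g z - f z\<bar> \<le> e"
    and z1: "\<And>j. j \<noteq> i \<Longrightarrow> \<bar>g (z + h *\<^sub>R axis j 1) - f (z + h *\<^sub>R axis j 1)\<bar> \<le> e"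
    and z2: "\<And>j. j \<noteq> i \<Longrightarrow> \<bar>g (z - h *\<^sub>R axis j 1) - f (z - h *\<^sub>R axis j 1)\<bar> \<le> e"
  shows "\<bar>g x - (f z + s \<bullet> (x - z))\<bar> \<le> 2 * (\<Sum>j\<in>-{i}. second_diff f h z j) + 7 * real CARD('d) * e"
proof -
  obtain s' where s': "subgradient i g z s'" using g tame_def by blast
  let ?D = "\<lambda>j. second_diff f h z j"
  have up: "g x - (g z + s' \<bullet> (x - z)) \<le> (\<Sum>j\<in>-{i}. second_diff g h z j)"
    by (rule tame_above_tangent[OF g s' h x])
  have lo: "g x - (g z + s' \<bullet> (x - z)) \<ge> 0" using subgradientD(3)[OF s', of x] by simp
  have dg: "second_diff g h z j \<le> ?D j + 4 * e" if "j \<noteq> i" for j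
    using z0 z1[OF that] z2[OF that] unfolding second_diff_def by linarith
  have ds: "\<bar>s' $ j - s $ j\<bar> * h \<le> ?D j + 2 * e" if "j \<noteq> i" for j
  proof -
    have "h * s' $ j - h * s $ j \<le> ?D j + 2 * e"
      using subgradient_step(1)[OF s', of h j] subgradient_step(2)[OF s, of h j] z0 z1[OF that]
      unfolding second_diff_def by linarith
    moreover have "h * s $ j - h * s' $ j \<le> ?D j + 2 * e"
      using subgradient_step(2)[OF s', of h j] subgradient_step(1)[OF s, of h j] z0 z2[OF that]
      unfolding second_diff_def by linarith
    ultimately have "\<bar>(s' $ j - s $ j) * h\<bar> \<le> ?D j + 2 * e" by (simp add: algebra_simps abs_le_iff)
    then show ?thesis using h by (simp add: abs_mult)
  qed
  have ri: "(s' - s) $ i = 0" using subgradientD(1)[OF s] subgradientD(1)[OF s'] by simp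
  have t: "\<bar>x $ j - z $ j\<bar> \<le> h" if "j \<noteq> i" for j
  proof -
    have "\<bar>x $ j - z $ j\<bar> \<le> (\<Sum>j\<in>-{i}. \<bar>x $ j - z $ j\<bar>)" using that by (intro member_le_sum) auto
    then show ?thesis using x by simp
  qed
  have "\<bar>(s' - s) \<bullet> (x - z)\<bar> \<le> (\<Sum>j\<in>-{i}. \<bar>(s' $ j - s $ j) * (x $ j - z $ j)\<bar>)"
    unfolding inner_off_coordinate[OF ri] by simp
  also have "\<dots> \<le> (\<Sum>j\<in>-{i}. ?D j + 2 * e)"
  proof (intro sum_mono)
    fix j assume "j \<in> -{i}" then have j: "j \<noteq> i" by simp
    have "\<bar>(s' $ j - s $ j) * (x $ j - z $ j)\<bar> \<le> \<bar>s' $ j - s $ j\<bar> * h"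
      unfolding abs_mult using t[OF j] by (intro mult_left_mono) auto
    then show "\<bar>(s' $ j - s $ j) * (x $ j - z $ j)\<bar> \<le> ?D j + 2 * e" using ds[OF j] by simp
  qed
  finally have A: "\<bar>(s' - s) \<bullet> (x - z)\<bar> \<le> (\<Sum>j\<in>-{i}. ?D j + 2 * e)" .
  have B: "(\<Sum>j\<in>-{i}. second_diff g h z j) \<le> (\<Sum>j\<in>-{i}. ?D j + 4 * e)"
    by (intro sum_mono dg) auto
  have "\<bar>g x - (f z + s \<bullet> (x - z))\<bar> \<le> e + (\<Sum>j\<in>-{i}. ?D j + 2 * e) + (\<Sum>j\<in>-{i}. ?D j + 4 * e)"
    using up lo A B z0 unfolding inner_diff_left by linarith
  also have "\<dots> = e + 2 * (\<Sum>j\<in>-{i}. ?D j) + 6 * real (card (-{i})) * e"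
    by (simp add: sum.distrib)
  also have "\<dots> \<le> 2 * (\<Sum>j\<in>-{i}. ?D j) + 7 * real CARD('d) * e"
  proof -
    have "1 * e \<le> real CARD('d) * e" using e by (intro mult_right_mono) (simp_all add: Suc_leI)
    moreover have "real (card (-{i})) * e \<le> real CARD('d) * e"
      using e by (intro mult_right_mono) (simp_all add: card_mono)
    ultimately show ?thesis by simp
  qed
  finally show ?thesis .
qed

section \<open>Thin shells around graphs\<close>

text \<open>A sheared box around a piece of a hyperplane. The sign \<open>\<sigma>\<close>
  distinguishes lower from upper parts of a convex surface.\<close>

definition slab :: "'d \<Rightarrow> real \<Rightarrow> real \<Rightarrow> real ^ 'd \<Rightarrow> real \<Rightarrow> real ^ 'd \<Rightarrow> real \<Rightarrow> (real ^ 'd) set"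
  where "slab i \<sigma> \<delta> z c s W =
    {x. (\<forall>j. j \<noteq> i \<longrightarrow> \<bar>x $ j - z $ j\<bar> \<le> \<delta>) \<and> \<bar>\<sigma> * x $ i - (c + s \<bullet> (x - z))\<bar> \<le> W}"

text \<open>Vertically stacked disjoint translates of the slab fit into a box.\<close>

lemma measure_slab:
  fixes z s :: "real ^ 'd"
  assumes \<sigma>: "\<sigma> = 1 \<or> \<sigma> = -1" and s: "s $ i = 0" "\<And>j. \<bar>s $ j\<bar> \<le> 1" and "\<delta> > 0" "W > 0"
  shows "slab i \<sigma> \<delta> z c s W \<in> lmeasurable"
    and "measure lebesgue (slab i \<sigma> \<delta> z c s W) \<le> (2 * \<delta>) ^ (CARD('d) - 1) * (5 * W)"
proof -
  let ?S = "slab i \<sigma> \<delta> z c s W"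
  define D where "D = real CARD('d) * \<delta>"
  have D: "D \<ge> 0" using \<open>\<delta> > 0\<close> by (simp add: D_def)
  have sx: "\<bar>s \<bullet> (x - z)\<bar> \<le> D" if "\<forall>j. j \<noteq> i \<longrightarrow> \<bar>x $ j - z $ j\<bar> \<le> \<delta>" for x
  proof -
    have "\<bar>s \<bullet> (x - z)\<bar> \<le> (\<Sum>j\<in>-{i}. \<bar>s $ j * (x - z) $ j\<bar>)"
      unfolding inner_off_coordinate[of s i, OF s(1)] by (rule sum_abs)
    also have "\<dots> \<le> (\<Sum>j\<in>-{i}. 1 * \<delta>)"
      unfolding abs_mult using that s(2) \<open>\<delta> > 0\<close> by (intro sum_mono mult_mono) auto
    also have "\<dots> = real (card (-{i})) * \<delta>" by simp
    also have "\<dots> \<le> D" unfolding D_def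
      using \<open>\<delta> > 0\<close> by (intro mult_right_mono) (auto intro: card_mono)
    finally show ?thesis .
  qed
  \<comment> \<open>With this many translates the tilt \<open>2 * D\<close> costs at most
    \<open>W\<close> per translate, so that the box has height at most
    \<open>5 * W * N'\<close>.\<close>
  obtain N where N: "2 * D / W \<le> real N" using real_arch_simple by blast
  define N' where "N' = Suc N"
  have N': "2 * D \<le> W * real N'" "real N' \<ge> 1"
    using N \<open>W > 0\<close> by (auto simp: N'_def field_simps)
  \<comment> \<open>The spacing \<open>3 * W\<close> exceeds the vertical thickness
    \<open>2 * W\<close> of the slab, which makes the translates disjoint.\<close>
  define v where "v k = (3 * W * real k) *\<^sub>R axis i (1::real)" for k :: nat
  define lo hi :: "real ^ 'd" where "lo = (\<chi> j. if j = i then \<sigma> * c - W - D else z $ j - \<delta>)"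
    and "hi = (\<chi> j. if j = i then \<sigma> * c + W + D + 3 * W * real N' - 3 * W else z $ j + \<delta>)"
  have inbox: "v k + x \<in> cbox lo hi" if "x \<in> ?S" "k < N'" for x k
  proof -
    have j: "\<forall>j. j \<noteq> i \<longrightarrow> \<bar>x $ j - z $ j\<bar> \<le> \<delta>" and i: "\<bar>\<sigma> * x $ i - (c + s \<bullet> (x - z))\<bar> \<le> W"
      using that by (auto simp: slab_def)
    have "\<bar>x $ i - \<sigma> * c\<bar> \<le> W + D"
      using \<sigma> i sx[OF j] by (auto simp: abs_le_iff)
    moreover have "3 * W * real k \<ge> 0" "3 * W * real k \<le> 3 * W * (real N' - 1)"
      using that \<open>W > 0\<close> by (auto intro!: mult_left_mono)
    ultimately have "\<sigma> * c - W - D \<le> (v k + x) $ i" "(v k + x) $ i \<le> \<sigma> * c + W + D + 3 * W * real N' - 3 * W"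
      by (auto simp: v_def axis_def algebra_simps abs_le_iff)
    then show ?thesis
      using j by (auto simp: mem_box_cart lo_def hi_def v_def axis_def abs_le_iff algebra_simps)
  qed
  have cl: "closed ?S"
  proof -
    have "?S = (\<Inter>j\<in>-{i}. {x. \<bar>x $ j - z $ j\<bar> \<le> \<delta>}) \<inter> {x. \<bar>\<sigma> * x $ i - (c + s \<bullet> (x - z))\<bar> \<le> W}"
      unfolding slab_def by auto
    also have "closed \<dots>"
      by (auto intro!: closed_Int closed_INT closed_Collect_le continuous_intros)
    finally show ?thesis .
  qed
  have "bounded ?S"
    using inbox[of _ 0] by (intro bounded_subset[OF bounded_cbox[of lo hi]]) (auto simp: v_def N'_def)
  then show M: "?S \<in> lmeasurable"
    using cl by (simp add: compact_eq_bounded_closed lmeasurable_compact)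
  have disj: "disjnt ((+) (v k) ` ?S) ((+) (v l) ` ?S)" if "k < l" for k l
  proof -
    have False if "x \<in> ?S" "y \<in> ?S" "v k + x = v l + y" for x y
    proof -
      have x: "x = y + (v l - v k)" using that(3) by (simp add: algebra_simps)
      have "s \<bullet> (x - z) = s \<bullet> (y - z)"
        unfolding x by (simp add: v_def inner_add_right inner_diff_right inner_axis s)
      moreover obtain t where "x $ i = y $ i + t" "t \<ge> 3 * W"
      proof
        show "x $ i = y $ i + 3 * W * (real l - real k)"
          unfolding x by (simp add: v_def axis_def algebra_simps)
        have "3 * W * (real l - real k) \<ge> 3 * W * 1"
          using \<open>k < l\<close> \<open>W > 0\<close> by (intro mult_left_mono) auto
        then show "3 * W * (real l - real k) \<ge> 3 * W" by simp
      qed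
      ultimately show False
        using that(1,2) \<sigma> \<open>W > 0\<close> by (auto simp: slab_def abs_le_iff)
    qed
    then show ?thesis by (auto simp: disjnt_def)
  qed
  have pw: "pairwise (\<lambda>k l. disjnt ((+) (v k) ` ?S) ((+) (v l) ` ?S)) {..<N'}"
    unfolding pairwise_def using disj by (metis disjnt_sym linorder_neqE_nat)
  have "real N' * measure lebesgue ?S = (\<Sum>k<N'. measure lebesgue ((+) (v k) ` ?S))"
    by (simp add: measure_translation)
  also have "\<dots> = measure lebesgue (\<Union>k<N'. (+) (v k) ` ?S)"
    using pw M by (intro measure_UNION'[symmetric]) (auto intro: measurable_translation)
  also have "\<dots> \<le> measure lebesgue (cbox lo hi)"
    using inbox M by (intro measure_mono_fmeasurable) (auto intro!: fmeasurableD measurable_translation sets.finite_UN)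
  also have "\<dots> = (\<Prod>j\<in>UNIV. hi $ j - lo $ j)"
  proof -
    have "W * 1 \<le> W * real N'" using N' \<open>W > 0\<close> by (intro mult_left_mono) auto
    then have "0 \<le> 2 * D + 3 * W * real N' - W" using D \<open>W > 0\<close> by linarith
    then have "cbox lo hi \<noteq> {}"
      using assms D by (auto simp: interval_ne_empty_cart lo_def hi_def)
    then show ?thesis using content_cbox_cart by simp
  qed
  also have "\<dots> = (hi $ i - lo $ i) * (\<Prod>j\<in>UNIV - {i}. hi $ j - lo $ j)"
    by (rule prod.remove) auto
  also have "(\<Prod>j\<in>UNIV - {i}. hi $ j - lo $ j) = (\<Prod>j\<in>UNIV - {i}. 2 * \<delta>)"
    by (intro prod.cong) (auto simp: hi_def lo_def)
  also have "\<dots> = (2 * \<delta>) ^ (CARD('d) - 1)"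
    by (simp add: card_Diff_singleton)
  also have "hi $ i - lo $ i = 2 * D + 3 * W * real N' - W" by (simp add: hi_def lo_def)
  also have "(2 * D + 3 * W * real N' - W) * (2 * \<delta>) ^ (CARD('d) - 1)
      \<le> (5 * W * real N') * (2 * \<delta>) ^ (CARD('d) - 1)"
  proof (intro mult_right_mono)
    have "0 \<le> W * real N'" using \<open>W > 0\<close> by simp
    then show "2 * D + 3 * W * real N' - W \<le> 5 * W * real N'" using N' \<open>W > 0\<close> by linarith
  qed (use \<open>\<delta> > 0\<close> in simp)
  finally have "real N' * measure lebesgue ?S \<le> real N' * ((2 * \<delta>) ^ (CARD('d) - 1) * (5 * W))"
    by (simp add: mult_ac)
  then show "measure lebesgue ?S \<le> (2 * \<delta>) ^ (CARD('d) - 1) * (5 * W)"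
    using N' by (simp add: mult_le_cancel_left_pos)
qed

text \<open>Coordinate \<open>i\<close> is frozen at 0 because tame functions ignore it, so the grid
  has dimension \<open>CARD('d) - 1\<close>.\<close>

definition grid :: "'d \<Rightarrow> nat \<Rightarrow> ('d \<Rightarrow> int) set"
  where "grid i H = {k. k i = 0 \<and> (\<forall>j. \<bar>k j\<bar> \<le> int H)}"

definition node :: "nat \<Rightarrow> ('d \<Rightarrow> int) \<Rightarrow> real ^ 'd"
  where "node M k = (\<chi> j. real_of_int (k j) / real M)"

section \<open>Counting grid nodes\<close>

lemma grid_eq: "grid (i::'d::finite) H = PiE UNIV (\<lambda>j. if j = i then {0} else {- int H..int H})"
proof (intro equalityI subsetI)
  fix k assume "k \<in> PiE UNIV (\<lambda>j. if j = i then {0} else {- int H..int H})"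
  then have *: "k j \<in> (if j = i then {0} else {- int H..int H})" for j by (rule PiE_mem) simp
  have "k i = 0" using *[of i] by simp
  moreover have "\<bar>k j\<bar> \<le> int H" for j using *[of j] by (auto split: if_splits)
  ultimately show "k \<in> grid i H" by (simp add: grid_def)
qed (auto simp: grid_def PiE_UNIV_domain abs_le_iff minus_le_iff)

lemma finite_grid: "finite (grid (i::'d::finite) H)"
  unfolding grid_eq by (intro finite_PiE) auto

lemma card_grid: "card (grid (i::'d::finite) H) = (2 * H + 1) ^ (CARD('d) - 1)"
proof -
  have "card (grid i H) = (\<Prod>j\<in>UNIV. card (if j = i then {0} else {- int H..int H}))"
    unfolding grid_eq by (rule card_PiE) simp
  also have "\<dots> = (\<Prod>j\<in>UNIV - {i}. card (if j = i then {0} else {- int H..int H}))"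
    by (subst prod.remove[of _ i]) auto
  also have "\<dots> = (\<Prod>j\<in>UNIV - {i}. 2 * H + 1)"
    by (intro prod.cong) auto
  finally show ?thesis by (simp add: card_Diff_singleton)
qed

text \<open>Serves twice: for the boundary layer left over by telescoping, and for a set with one
  representative per grid line.\<close>

lemma card_grid_slice:
  fixes i :: "'d::finite"
  assumes "j \<noteq> i" and A: "finite A"
  shows "finite {k \<in> grid i H. k j \<in> A}" "card {k \<in> grid i H. k j \<in> A} \<le> card A * (2 * H + 1) ^ (CARD('d) - 2)"
proof -
  let ?B = "\<lambda>l. if l = i then {0} else if l = j then A else {- int H..int H}"
  have sub: "{k \<in> grid i H. k j \<in> A} \<subseteq> PiE UNIV ?B"
    unfolding grid_def PiE_UNIV_domain using assms by (auto simp: Pi_iff abs_le_iff) (smt (verit))+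
  have fin: "finite (PiE UNIV ?B)" using A by (intro finite_PiE) auto
  show "finite {k \<in> grid i H. k j \<in> A}" using sub fin finite_subset by blast
  have "card {k \<in> grid i H. k j \<in> A} \<le> card (PiE UNIV ?B)" using sub fin card_mono by blast
  also have "\<dots> = (\<Prod>l\<in>UNIV. card (?B l))" by (rule card_PiE) simp
  also have "\<dots> = (\<Prod>l\<in>UNIV - {i}. card (?B l))" by (subst prod.remove[of _ i]) auto
  also have "\<dots> = card A * (\<Prod>l\<in>UNIV - {i} - {j}. card (?B l))"
    using assms by (subst prod.remove[of _ j]) auto
  also have "(\<Prod>l\<in>UNIV - {i} - {j}. card (?B l)) = (\<Prod>l\<in>UNIV - {i} - {j}. 2 * H + 1)"
    by (intro prod.cong) auto
  also have "\<dots> = (2 * H + 1) ^ (CARD('d) - 2)"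
    using assms by (simp add: card_Diff_singleton numeral_2_eq_2)
  finally show "card {k \<in> grid i H. k j \<in> A} \<le> card A * (2 * H + 1) ^ (CARD('d) - 2)" .
qed

lemma node_shift:
  fixes k :: "'d::finite \<Rightarrow> int"
  shows "node M (k(j := k j + n)) = node M k + (real_of_int n / real M) *\<^sub>R axis j 1"
  by (simp add: vec_eq_iff node_def axis_def add_divide_distrib)

text \<open>Along every grid line the second differences telescope to a difference of two slopes.\<close>

lemma sum_second_diff_le:
  fixes f :: "real ^ 'd \<Rightarrow> real"
  assumes f: "tame i f" and "j \<noteq> i" "M \<ge> 1"
  shows "(\<Sum>k\<in>grid i M. second_diff f (real m / real M) (node M k) j)
    \<le> 2 * (real m / real M) * (real m * (2 * real M + 1) ^ (CARD('d) - 2))"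
proof -
  let ?h = "real m / real M"
  define g where "g k = f (node M k + ?h *\<^sub>R axis j 1) - f (node M k)" for k
  \<comment> \<open>Moving back by \<open>m\<close> grid steps turns a second difference into an
    increment minus the shifted increment.\<close>
  define \<tau> where "\<tau> k = k(j := k j + - int m)" for k :: "'d \<Rightarrow> int"
  let ?K = "grid i M" and ?K' = "\<tau> ` grid i M"
  have inj: "inj \<tau>"
  proof (rule injI)
    fix k l assume "\<tau> k = \<tau> l"
    then have "(\<tau> k)(j := \<tau> k j + int m) = (\<tau> l)(j := \<tau> l j + int m)" by simp
    then show "k = l" by (simp add: \<tau>_def)
  qed
  have fin: "finite ?K" "finite ?K'" by (auto simp: finite_grid)
  have eq: "second_diff f ?h (node M k) j = g k - g (\<tau> k)" for k
  proof -
    have "node M (\<tau> k) = node M k - ?h *\<^sub>R axis j 1"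
      unfolding \<tau>_def node_shift by simp
    then show ?thesis by (simp add: g_def second_diff_def)
  qed
  have gb: "\<bar>g k\<bar> \<le> ?h" for k
    using tame_step[OF f, of "node M k" ?h j] by (simp add: g_def)
  have cardeq: "card (?K' - ?K) = card (?K - ?K')"
    using card_image[OF inj_on_subset[OF inj], of ?K] fin card_Diff_subset_Int[of ?K' ?K] card_Diff_subset_Int[of ?K ?K']
    by (simp add: Int_commute)
  have "?K - ?K' \<subseteq> {k \<in> grid i M. k j \<in> {int M - int m<..int M}}"
  proof
    fix k assume k: "k \<in> ?K - ?K'"
    have "\<not> k j + int m \<le> int M"
    proof
      assume le: "k j + int m \<le> int M"
      have "k(j := k j + int m) \<in> ?K"
        using k le \<open>j \<noteq> i\<close> unfolding grid_def by (smt (verit) DiffD1 fun_upd_apply mem_Collect_eq of_nat_0_le_iff)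
      moreover have "\<tau> (k(j := k j + int m)) = k" by (simp add: \<tau>_def)
      ultimately have "k \<in> ?K'" by (metis image_eqI)
      then show False using k by simp
    qed
    then show "k \<in> {k \<in> grid i M. k j \<in> {int M - int m<..int M}}"
      using k by (auto simp: grid_def abs_le_iff)
  qed
  then have "card (?K - ?K') \<le> card {k \<in> grid i M. k j \<in> {int M - int m<..int M}}"
    by (intro card_mono card_grid_slice(1) assms) auto
  also have "\<dots> \<le> card {int M - int m<..int M} * (2 * M + 1) ^ (CARD('d) - 2)"
    by (intro card_grid_slice(2) assms) auto
  finally have "real (card (?K - ?K')) \<le> real (m * (2 * M + 1) ^ (CARD('d) - 2))"
    by (subst of_nat_le_iff) simp
  then have cb: "real (card (?K - ?K')) \<le> real m * (2 * real M + 1) ^ (CARD('d) - 2)"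
    by (simp add: add.commute)
  \<comment> \<open>The nodes common to both sums cancel. Two leftover layers of equal size remain,
    on which the increments are at most \<open>m / M\<close> in absolute value.\<close>
  have "(\<Sum>k\<in>?K. second_diff f ?h (node M k) j) = (\<Sum>k\<in>?K. g k) - (\<Sum>k\<in>?K'. g k)"
    by (simp add: eq sum_subtractf sum.reindex[OF inj_on_subset[OF inj]])
  also have "\<dots> = (\<Sum>k\<in>?K - ?K'. g k) - (\<Sum>k\<in>?K' - ?K. g k)"
    using sum.Int_Diff[OF fin(1), of g ?K'] sum.Int_Diff[OF fin(2), of g ?K] by (simp add: Int_commute)
  also have "\<dots> \<le> (\<Sum>k\<in>?K - ?K'. ?h) + (\<Sum>k\<in>?K' - ?K. ?h)"
  proof -
    have "(\<Sum>k\<in>?K - ?K'. g k) \<le> (\<Sum>k\<in>?K - ?K'. ?h)"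
      by (intro sum_mono) (use gb in \<open>smt (verit)\<close>)
    moreover have "(\<Sum>k\<in>?K' - ?K. - g k) \<le> (\<Sum>k\<in>?K' - ?K. ?h)"
      by (intro sum_mono) (use gb in \<open>smt (verit)\<close>)
    ultimately show ?thesis by (simp add: sum_negf)
  qed
  also have "\<dots> = 2 * ?h * real (card (?K - ?K'))"
    by (simp add: cardeq)
  also have "\<dots> \<le> 2 * ?h * (real m * (2 * real M + 1) ^ (CARD('d) - 2))"
    by (intro mult_left_mono cb) auto
  finally show ?thesis .
qed

text \<open>In the coordinates other than \<open>i\<close>, the step \<open>CARD('d) / M\<close>
  makes the cross-polytope around a node contain the cell of half-side \<open>1 / (2 * M)\<close>.
  The width is the bound of \<open>tame_near_tangent\<close> for \<open>e = 1 / M ^ 2\<close>.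
  Fixing one subgradient by \<open>SOME\<close> lets the shell depend on \<open>f\<close>
  alone.\<close>

definition shell :: "real \<Rightarrow> nat \<Rightarrow> 'd \<Rightarrow> (real ^ 'd \<Rightarrow> real) \<Rightarrow> (real ^ 'd) set"
  where "shell \<sigma> M i f = (\<Union>k\<in>grid i M.
    slab i \<sigma> (1 / (2 * real M)) (node M k) (f (node M k)) (SOME s. subgradient i f (node M k) s)
      (2 * (\<Sum>j\<in>-{i}. second_diff f (real CARD('d) / real M) (node M k) j) + 7 * real CARD('d) / real M ^ 2))"

text \<open>Write d for \<open>CARD('d)\<close>. Each cell has base volume M^(1-d). The widths add
  up to order M^(d-3): the second differences telescope, and each of about M^(d-1) nodes adds a
  multiple of 1/M^2. The product is of order 1/M^2.\<close>

lemma measure_shell: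
  fixes f :: "real ^ 'd \<Rightarrow> real"
  assumes f: "tame i f" and \<sigma>: "\<sigma> = 1 \<or> \<sigma> = -1" and M: "M \<ge> 1" and d: "CARD('d) \<ge> 2"
  shows "shell \<sigma> M i f \<in> lmeasurable"
    and "measure lebesgue (shell \<sigma> M i f) \<le> 55 * real CARD('d) ^ 3 * 3 ^ CARD('d) / real M ^ 2"
proof -
  define D where "D = real CARD('d)"
  have D: "D \<ge> 2" using d by (simp add: D_def)
  define e where "e = CARD('d) - 2"
  have e: "CARD('d) = e + 2" using d by (simp add: e_def)
  define W where "W k = 2 * (\<Sum>j\<in>-{i}. second_diff f (D / real M) (node M k) j) + 7 * D / real M ^ 2" for k
  let ?s = "\<lambda>k. SOME s. subgradient i f (node M k) s"
  let ?S = "\<lambda>k. slab i \<sigma> (1 / (2 * real M)) (node M k) (f (node M k)) (?s k) (W k)"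
  have sh: "shell \<sigma> M i f = (\<Union>k\<in>grid i M. ?S k)" by (simp add: shell_def W_def D_def)
  have s: "subgradient i f (node M k) (?s k)" for k
    using f unfolding tame_def by (intro someI_ex[of "subgradient i f (node M k)"]) auto
  have W: "W k > 0" for k
  proof -
    have "(\<Sum>j\<in>-{i}. second_diff f (D / real M) (node M k) j) \<ge> 0"
      by (intro sum_nonneg tame_second_diff_nonneg[OF f])
    moreover have "7 * D / real M ^ 2 > 0" using D M by simp
    ultimately show ?thesis by (simp add: W_def)
  qed
  have S: "?S k \<in> lmeasurable" "measure lebesgue (?S k) \<le> (2 * (1 / (2 * real M))) ^ (CARD('d) - 1) * (5 * W k)" for k
    using measure_slab[OF \<sigma> subgradientD(1)[OF s[of k]] subgradientD(2)[OF s[of k]] _ W[of k], of "1 / (2 * real M)"] M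
    by auto
  show "shell \<sigma> M i f \<in> lmeasurable"
    unfolding sh using S(1) finite_grid by (intro fmeasurable.finite_UN) auto
  have M3: "(2 * real M + 1) ^ n \<le> 3 ^ n * real M ^ n" for n
    unfolding power_mult_distrib[symmetric] using M by (intro power_mono) auto
  have 3: "(3::real) ^ (CARD('d) - 1) \<le> 3 ^ CARD('d)" "(3::real) ^ e \<le> 3 ^ CARD('d)"
    by (intro power_increasing; simp add: e)+
  have Mp: "real M ^ e \<ge> 0" "real M > 0" using M by auto
  have "(\<Sum>k\<in>grid i M. W k)
      = 2 * (\<Sum>j\<in>-{i}. \<Sum>k\<in>grid i M. second_diff f (D / real M) (node M k) j) + real (card (grid i M)) * (7 * D / real M ^ 2)"
    unfolding W_def sum.distrib sum_distrib_left[symmetric] by (subst sum.swap) simp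
  also have "(\<Sum>j\<in>-{i}. \<Sum>k\<in>grid i M. second_diff f (D / real M) (node M k) j) \<le> (\<Sum>j\<in>-{i}. 2 * D ^ 2 * 3 ^ CARD('d) * (real M ^ e / real M))"
  proof (intro sum_mono)
    fix j assume "j \<in> -{i}"
    then have "(\<Sum>k\<in>grid i M. second_diff f (D / real M) (node M k) j)
        \<le> 2 * (D / real M) * (D * (2 * real M + 1) ^ e)"
      unfolding D_def e_def using sum_second_diff_le[OF f _ M] by auto
    also have "\<dots> \<le> 2 * (D / real M) * (D * (3 ^ CARD('d) * real M ^ e))"
    proof -
      have "3 ^ e * real M ^ e \<le> 3 ^ CARD('d) * real M ^ e" using 3(2) Mp by (intro mult_right_mono) auto
      then have "(2 * real M + 1) ^ e \<le> 3 ^ CARD('d) * real M ^ e" using M3[of e] by linarith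
      then show ?thesis using D Mp by (intro mult_left_mono) auto
    qed
    also have "\<dots> = 2 * D ^ 2 * 3 ^ CARD('d) * (real M ^ e / real M)"
      by (simp add: power2_eq_square)
    finally show "(\<Sum>k\<in>grid i M. second_diff f (D / real M) (node M k) j) \<le> 2 * D ^ 2 * 3 ^ CARD('d) * (real M ^ e / real M)" .
  qed
  also have "\<dots> = real (card (-{i})) * (2 * D ^ 2 * 3 ^ CARD('d) * (real M ^ e / real M))" by simp
  also have "\<dots> \<le> D * (2 * D ^ 2 * 3 ^ CARD('d) * (real M ^ e / real M))"
    unfolding D_def by (intro mult_right_mono) (auto intro: card_mono)
  also have "real (card (grid i M)) * (7 * D / real M ^ 2) \<le> (3 ^ CARD('d) * real M ^ (e + 1)) * (7 * D / real M ^ 2)"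
  proof -
    have "real (card (grid i M)) = (2 * real M + 1) ^ (e + 1)" by (simp add: card_grid e algebra_simps)
    also have "\<dots> \<le> 3 ^ (e + 1) * real M ^ (e + 1)" by (rule M3)
    also have "\<dots> \<le> 3 ^ CARD('d) * real M ^ (e + 1)" by (simp add: e)
    finally show ?thesis using D by (intro mult_right_mono) auto
  qed
  also have "(3 ^ CARD('d) * real M ^ (e + 1)) * (7 * D / real M ^ 2) = 7 * D * 3 ^ CARD('d) * (real M ^ e / real M)"
    using Mp by (simp add: power2_eq_square)
  also have "7 * D * 3 ^ CARD('d) * (real M ^ e / real M) \<le> 7 * D ^ 3 * 3 ^ CARD('d) * (real M ^ e / real M)"
    using D Mp self_le_power[of D 3] by (intro mult_right_mono mult_left_mono) auto
  \<comment> \<open>The coefficient is 11 = 4 + 7: the factor 2 in the width times the 2 from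
    telescoping, plus the rounding term. The factor 5 of \<open>measure_slab\<close> then yields
    55.\<close>
  finally have sumW: "(\<Sum>k\<in>grid i M. W k) \<le> 11 * D ^ 3 * 3 ^ CARD('d) * (real M ^ e / real M)"
    by (simp add: power2_eq_square power3_eq_cube mult_ac)
  have "measure lebesgue (shell \<sigma> M i f) \<le> (\<Sum>k\<in>grid i M. measure lebesgue (?S k))"
    unfolding sh using S(1) by (intro measure_UNION_le finite_grid) (auto intro: fmeasurableD)
  also have "\<dots> \<le> (\<Sum>k\<in>grid i M. (1 / real M) ^ (e + 1) * 5 * W k)"
    using S(2) by (intro sum_mono) (simp add: e mult_ac)
  also have "\<dots> = (1 / real M) ^ (e + 1) * 5 * (\<Sum>k\<in>grid i M. W k)"
    by (simp add: sum_distrib_left)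
  also have "\<dots> \<le> (1 / real M) ^ (e + 1) * 5 * (11 * D ^ 3 * 3 ^ CARD('d) * (real M ^ e / real M))"
    by (intro mult_left_mono sumW) auto
  also have "\<dots> = 55 * D ^ 3 * 3 ^ CARD('d) / real M ^ 2"
    using Mp by (simp add: field_simps power2_eq_square)
  finally show "measure lebesgue (shell \<sigma> M i f) \<le> 55 * real CARD('d) ^ 3 * 3 ^ CARD('d) / real M ^ 2"
    by (simp add: D_def)
qed

text \<open>Rounding the coordinates other than \<open>i\<close> sends \<open>x\<close> to a grid
  node, and the neighbours used to control the slope lie \<open>CARD('d)\<close> steps away. Hence
  closeness is demanded on the grid enlarged by \<open>CARD('d)\<close>.\<close>

lemma graph_subset_shell:
  fixes f g :: "real ^ 'd \<Rightarrow> real"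
  assumes f: "tame i f" and g: "tame i g" and M: "M \<ge> 1"
    and close: "\<And>k. k \<in> grid i (M + CARD('d)) \<Longrightarrow> \<bar>g (node M k) - f (node M k)\<bar> \<le> 1 / real M ^ 2"
    and x: "x \<in> cball 0 1" "g x = \<sigma> * x $ i"
  shows "x \<in> shell \<sigma> M i f"
proof -
  define k where "k j = (if j = i then 0 else round (x $ j * real M))" for j
  define h where "h = real CARD('d) / real M"
  have h: "h > 0" using M by (simp add: h_def)
  have kM: "\<bar>k j\<bar> \<le> int M" for j
  proof -
    have "\<bar>x $ j\<bar> \<le> 1" using component_le_norm_cart[of x j] x(1) by simp
    then have "\<bar>x $ j * real M\<bar> \<le> real M" using mult_right_mono[of "\<bar>x $ j\<bar>" 1 "real M"] by (simp add: abs_mult)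
    then have "x $ j * real M \<le> real_of_int (int M)" "real_of_int (- int M) \<le> x $ j * real M"
      by (auto simp: abs_le_iff)
    then have "round (x $ j * real M) \<le> int M" "- int M \<le> round (x $ j * real M)"
      using round_mono round_of_int by metis+
    then show ?thesis by (simp add: k_def abs_le_iff)
  qed
  have k: "k \<in> grid i M" using kM by (simp add: grid_def k_def)
  let ?z = "node M k"
  have xj: "\<bar>x $ j - ?z $ j\<bar> \<le> 1 / (2 * real M)" if "j \<noteq> i" for j
  proof -
    have "\<bar>x $ j * real M - real_of_int (k j)\<bar> \<le> 1 / 2"
      using of_int_round_abs_le[of "x $ j * real M"] that by (simp add: k_def abs_minus_commute)
    then have "\<bar>x $ j * real M - real_of_int (k j)\<bar> / real M \<le> 1 / 2 / real M"
      by (intro divide_right_mono) auto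
    moreover have "\<bar>x $ j * real M - real_of_int (k j)\<bar> / real M = \<bar>x $ j - ?z $ j\<bar>"
    proof -
      have "x $ j - ?z $ j = (x $ j * real M - real_of_int (k j)) / real M"
        using M by (simp add: node_def field_simps)
      then show ?thesis by (simp add: abs_divide)
    qed
    ultimately show ?thesis by simp
  qed
  have l1: "(\<Sum>j\<in>-{i}. \<bar>x $ j - ?z $ j\<bar>) \<le> h"
  proof -
    have "(\<Sum>j\<in>-{i}. \<bar>x $ j - ?z $ j\<bar>) \<le> (\<Sum>j\<in>-{i}. 1 / real M)"
    proof (intro sum_mono)
      fix j assume "j \<in> -{i}"
      then have "\<bar>x $ j - ?z $ j\<bar> \<le> 1 / (2 * real M)" using xj by auto
      also have "\<dots> \<le> 1 / real M" using M by (simp add: field_simps)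
      finally show "\<bar>x $ j - ?z $ j\<bar> \<le> 1 / real M" .
    qed
    also have "\<dots> = real (card (-{i})) / real M" by simp
    also have "\<dots> \<le> h" unfolding h_def by (intro divide_right_mono) (auto intro: card_mono)
    finally show ?thesis .
  qed
  have c0: "\<bar>g ?z - f ?z\<bar> \<le> 1 / real M ^ 2"
    using k by (intro close) (auto simp: grid_def intro: order_trans)
  have sh: "k(j := k j + n) \<in> grid i (M + CARD('d))" if "j \<noteq> i" "\<bar>n\<bar> \<le> int CARD('d)" for j n
    using kM that by (auto simp: grid_def k_def) (smt (verit))+
  have c1: "\<bar>g (?z + h *\<^sub>R axis j 1) - f (?z + h *\<^sub>R axis j 1)\<bar> \<le> 1 / real M ^ 2" if "j \<noteq> i" for j
    using close[OF sh[OF that, of "int CARD('d)"]] by (simp add: node_shift h_def)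
  have c2: "\<bar>g (?z - h *\<^sub>R axis j 1) - f (?z - h *\<^sub>R axis j 1)\<bar> \<le> 1 / real M ^ 2" if "j \<noteq> i" for j
  proof -
    have eq: "node M (k(j := k j + - int CARD('d))) = ?z - h *\<^sub>R axis j 1"
      unfolding node_shift by (simp add: h_def)
    show ?thesis using close[OF sh[OF that, of "- int CARD('d)"]] unfolding eq by simp
  qed
  have s: "subgradient i f ?z (SOME s. subgradient i f ?z s)"
    using f unfolding tame_def by (intro someI_ex[of "subgradient i f ?z"]) auto
  have "\<bar>g x - (f ?z + (SOME s. subgradient i f ?z s) \<bullet> (x - ?z))\<bar>
      \<le> 2 * (\<Sum>j\<in>-{i}. second_diff f h ?z j) + 7 * real CARD('d) * (1 / real M ^ 2)"
    by (rule tame_near_tangent[OF f g s h l1 _ c0 c1 c2]) auto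
  then have "x \<in> slab i \<sigma> (1 / (2 * real M)) ?z (f ?z) (SOME s. subgradient i f ?z s)
      (2 * (\<Sum>j\<in>-{i}. second_diff f (real CARD('d) / real M) ?z j) + 7 * real CARD('d) / real M ^ 2)"
    using xj x(2) by (simp add: slab_def h_def)
  then show ?thesis unfolding shell_def using k by blast
qed

section \<open>Counting rounded convex functions\<close>

lemma sum_half_powers_le:
  "(\<Sum>v\<in>{- int T..int T}. (1/2::real) ^ nat \<bar>v\<bar>) \<le> 3"
proof -
  have "(\<Sum>v\<in>{- int T..int T}. (1/2::real) ^ nat \<bar>v\<bar>) = 3 - 2 * (1/2) ^ T"
  proof (induction T)
    case (Suc T)
    have "{- int (Suc T)..int (Suc T)} = insert (- int (Suc T)) (insert (int (Suc T)) {- int T..int T})" by auto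
    moreover have "nat \<bar>- 1 - int T\<bar> = Suc T" "nat \<bar>1 + int T\<bar> = Suc T" by auto
    ultimately show ?case using Suc by simp
  qed simp
  then show ?thesis by simp
qed

text \<open>Each element \<open>a\<close> of the set has weight \<open>\<Prod>k. 2 ^ (- \<bar>a k\<bar>) \<ge> 2 ^ (- T)\<close>, while the total
  weight of all integer vectors factors.\<close>

lemma card_l1_ball_le:
  assumes "finite I"
  shows "finite {a \<in> PiE I (\<lambda>_. UNIV :: int set). (\<Sum>k\<in>I. \<bar>a k\<bar>) \<le> int T}"
    and "real (card {a \<in> PiE I (\<lambda>_. UNIV :: int set). (\<Sum>k\<in>I. \<bar>a k\<bar>) \<le> int T}) \<le> 2 ^ T * 3 ^ card I"
proof -
  let ?A = "{a \<in> PiE I (\<lambda>_. UNIV :: int set). (\<Sum>k\<in>I. \<bar>a k\<bar>) \<le> int T}"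
  let ?B = "PiE I (\<lambda>_. {- int T..int T})"
  let ?w = "\<lambda>a. \<Prod>k\<in>I. (1/2::real) ^ nat \<bar>a k\<bar>"
  have sub: "?A \<subseteq> ?B"
  proof
    fix a assume a: "a \<in> ?A"
    have "\<bar>a k\<bar> \<le> int T" if "k \<in> I" for k
    proof -
      have "\<bar>a k\<bar> \<le> (\<Sum>k\<in>I. \<bar>a k\<bar>)" using assms that by (intro member_le_sum) auto
      then show ?thesis using a by simp
    qed
    then show "a \<in> ?B" using a by (auto simp: PiE_iff abs_le_iff minus_le_iff)
  qed
  have fin: "finite ?B" using assms by (intro finite_PiE) auto
  show finA: "finite ?A" using finite_subset[OF sub fin] .
  have "(1/2::real) ^ T \<le> ?w a" if "a \<in> ?A" for a
  proof -
    have "int (\<Sum>k\<in>I. nat \<bar>a k\<bar>) \<le> int T" using that by simp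
    then have "(\<Sum>k\<in>I. nat \<bar>a k\<bar>) \<le> T" by linarith
    then have "(1/2::real) ^ T \<le> (1/2) ^ (\<Sum>k\<in>I. nat \<bar>a k\<bar>)" by (intro power_decreasing) auto
    then show ?thesis by (simp add: power_sum)
  qed
  then have "(\<Sum>a\<in>?A. (1/2::real) ^ T) \<le> (\<Sum>a\<in>?A. ?w a)" by (intro sum_mono) auto
  also have "\<dots> \<le> (\<Sum>a\<in>?B. ?w a)"
    using sub fin by (intro sum_mono2) (auto intro: prod_nonneg)
  also have "\<dots> = (\<Prod>k\<in>I. \<Sum>v\<in>{- int T..int T}. (1/2::real) ^ nat \<bar>v\<bar>)"
    by (rule prod_sum_PiE[symmetric]) (use assms in auto)
  also have "\<dots> \<le> (\<Prod>k\<in>I. 3)"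
    using sum_half_powers_le by (intro prod_mono) (auto intro: sum_nonneg)
  finally have "real (card ?A) * (1/2) ^ T \<le> 3 ^ card I" by simp
  then have "real (card ?A) * (1/2) ^ T * 2 ^ T \<le> 3 ^ card I * 2 ^ T" by (rule mult_right_mono) simp
  then show "real (card ?A) \<le> 2 ^ T * 3 ^ card I"
    by (simp add: power_one_over mult.commute)
qed

text \<open>Rounding can destroy convexity, but the sum of the absolute second differences stays
  bounded, and this is what is counted. The conditions on the first two terms leave finitely many
  starting values and slopes.\<close>

definition rough_convex :: "nat \<Rightarrow> nat \<Rightarrow> nat \<Rightarrow> (nat \<Rightarrow> int) set"
  where "rough_convex m A T = {s \<in> PiE {..m} (\<lambda>_. UNIV). \<bar>s 0\<bar> \<le> int A \<and> \<bar>s 1 - s 0\<bar> \<le> int A \<and>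
    (\<Sum>k\<in>{1..<m}. \<bar>s (k + 1) - 2 * s k + s (k - 1)\<bar>) \<le> int T}"

text \<open>A sequence is recovered from its first value, its first difference and its second
  differences. The latter form an integer point of a ball in the sum norm.\<close>

lemma card_rough_convex_le:
  assumes "m \<ge> 1"
  shows "finite (rough_convex m A T)" "real (card (rough_convex m A T)) \<le> real (2 * A + 1) ^ 2 * (2 ^ T * 3 ^ m)"
proof -
  let ?L = "{a \<in> PiE {1..<m} (\<lambda>_. UNIV :: int set). (\<Sum>k\<in>{1..<m}. \<bar>a k\<bar>) \<le> int T}"
  let ?I = "{- int A..int A}"
  define \<Phi> where "\<Phi> s = (s 0, s 1 - s 0, restrict (\<lambda>k. s (k + 1) - 2 * s k + s (k - 1)) {1..<m})"
    for s :: "nat \<Rightarrow> int"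
  have inj: "inj_on \<Phi> (rough_convex m A T)"
  proof (rule inj_onI)
    fix s t assume s: "s \<in> rough_convex m A T" and t: "t \<in> rough_convex m A T" and eq: "\<Phi> s = \<Phi> t"
    have 01: "s 0 = t 0" "s 1 = t 1" using eq by (auto simp: \<Phi>_def)
    have rec: "s (k + 1) - 2 * s k + s (k - 1) = t (k + 1) - 2 * t k + t (k - 1)" if "k \<in> {1..<m}" for k
    proof -
      have "restrict (\<lambda>k. s (k + 1) - 2 * s k + s (k - 1)) {1..<m} k = restrict (\<lambda>k. t (k + 1) - 2 * t k + t (k - 1)) {1..<m} k"
        using arg_cong[OF eq, of "\<lambda>p. snd (snd p) k"] by (simp only: \<Phi>_def snd_conv)
      then show ?thesis using that by simp
    qed
    have "k \<le> m \<longrightarrow> s k = t k" for k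
    proof (induction k rule: less_induct)
      case (less k)
      show ?case
      proof (cases "k \<le> 1")
        case True
        then have "k = 0 \<or> k = 1" by linarith
        then show ?thesis using 01 by auto
      next
        case False
        then obtain l where l: "k = l + 1" "l \<ge> 1" by (cases k) auto
        have "s (l + 1) = t (l + 1)" if "k \<le> m"
            using less[of l] less[of "l - 1"] rec[of l] l that by simp
          then show ?thesis using l by simp
      qed
    qed
    moreover have "s k = undefined" "t k = undefined" if "\<not> k \<le> m" for k
      using s t that by (auto simp: rough_convex_def PiE_def extensional_def)
    ultimately show "s = t" by (metis ext)
  qed
  have img: "\<Phi> ` rough_convex m A T \<subseteq> ?I \<times> ?I \<times> ?L"
    by (auto simp: rough_convex_def \<Phi>_def abs_le_iff)
  have fin: "finite (?I \<times> ?I \<times> ?L)"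
    using card_l1_ball_le(1)[of "{1..<m}" T] by simp
  show "finite (rough_convex m A T)"
    using inj_on_finite[OF inj img fin] .
  have "card (rough_convex m A T) \<le> card (?I \<times> ?I \<times> ?L)"
    by (rule card_inj_on_le[OF inj img fin])
  also have "\<dots> = (2 * A + 1) * ((2 * A + 1) * card ?L)"
  proof -
    have "card ?I = 2 * A + 1" by simp
    then show ?thesis unfolding card_cartesian_product by (simp only:)
  qed
  finally have "real (card (rough_convex m A T)) \<le> real ((2 * A + 1) * ((2 * A + 1) * card ?L))"
    by (subst of_nat_le_iff)
  also have "\<dots> = real (2 * A + 1) ^ 2 * real (card ?L)"
    by (simp only: of_nat_mult power2_eq_square mult.assoc)
  also have "\<dots> \<le> real (2 * A + 1) ^ 2 * (2 ^ T * 3 ^ card {1..<m})"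
    by (intro mult_left_mono card_l1_ball_le(2)) auto
  also have "\<dots> \<le> real (2 * A + 1) ^ 2 * (2 ^ T * 3 ^ m)"
    by (intro mult_left_mono power_increasing) auto
  finally show "real (card (rough_convex m A T)) \<le> real (2 * A + 1) ^ 2 * (2 ^ T * 3 ^ m)" .
qed

text \<open>Rounding changes each second difference by at most 2. Before rounding they are
  nonnegative and telescope to a difference of two slopes.\<close>

lemma sum_abs_second_diff_floor_le:
  fixes u :: "nat \<Rightarrow> real"
  assumes conv: "\<And>k. 1 \<le> k \<Longrightarrow> k < m \<Longrightarrow> u (k + 1) - 2 * u k + u (k - 1) \<ge> 0"
    and slope: "\<And>k. \<bar>u (k + 1) - u k\<bar> \<le> L" and m: "m \<ge> 1"
  shows "real_of_int (\<Sum>k\<in>{1..<m}. \<bar>\<lfloor>u (k + 1)\<rfloor> - 2 * \<lfloor>u k\<rfloor> + \<lfloor>u (k - 1)\<rfloor>\<bar>) \<le> 2 * L + 2 * real m"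
proof -
  let ?d = "\<lambda>k. \<bar>\<lfloor>u (k + 1)\<rfloor> - 2 * \<lfloor>u k\<rfloor> + \<lfloor>u (k - 1)\<rfloor>\<bar>"
  have "real_of_int (?d k) \<le> (u (k + 1) - 2 * u k + u (k - 1)) + 2" if "k \<in> {1..<m}" for k
  proof -
    have "u (k + 1) - 2 * u k + u (k - 1) \<ge> 0" using conv[of k] that by auto
    then show ?thesis
      using floor_correct[of "u (k+1)"] floor_correct[of "u k"] floor_correct[of "u (k-1)"]
      unfolding of_int_abs of_int_add of_int_diff of_int_mult of_int_numeral of_int_1 by linarith
  qed
  then have "(\<Sum>k\<in>{1..<m}. real_of_int (?d k)) \<le> (\<Sum>k\<in>{1..<m}. (u (k + 1) - 2 * u k + u (k - 1)) + 2)"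
    by (rule sum_mono)
  also have "\<dots> = (\<Sum>k\<in>{1..<m}. u (k + 1) - 2 * u k + u (k - 1)) + 2 * real (m - 1)"
    by (simp add: sum.distrib)
  also have "(\<Sum>k\<in>{1..<m}. u (k + 1) - 2 * u k + u (k - 1)) = (u m - u (m - 1)) - (u 1 - u 0)"
  proof -
    have "(\<Sum>k\<in>{1..<Suc n}. u (k + 1) - 2 * u k + u (k - 1)) = (u (Suc n) - u n) - (u 1 - u 0)" for n
      by (induction n) auto
    from this[of "m - 1"] show ?thesis using m by simp
  qed
  also have "\<dots> \<le> 2 * L"
    using slope[of "m - 1"] slope[of 0] m by (simp add: abs_le_iff)
  finally show ?thesis using m by simp
qed

lemma tame_bound:
  fixes f :: "real ^ 'd \<Rightarrow> real"
  assumes f: "tame i f" and x: "\<And>j. \<bar>x $ j\<bar> \<le> B"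
  shows "\<bar>f x\<bar> \<le> real CARD('d) + 1 + real CARD('d) * B"
proof -
  have "\<bar>f x - f 0\<bar> \<le> (\<Sum>j\<in>(UNIV::'d set). \<bar>x $ j - 0 $ j\<bar>)" using tame_lipschitz[OF f] .
  also have "\<dots> \<le> (\<Sum>j\<in>(UNIV::'d set). B)" using x by (intro sum_mono) auto
  finally have "\<bar>f x - f 0\<bar> \<le> real CARD('d) * B" by simp
  moreover have "\<bar>f 0\<bar> \<le> real CARD('d) + 1" using f by (simp add: tame_def)
  ultimately show ?thesis by linarith
qed

section \<open>Absorbing counting factors into exponentials\<close>

lemma exp_bound_pow2:
  assumes "M \<ge> 1" "c \<ge> 0"
  shows "c * real M ^ 2 \<le> exp ((c + 2) * real M)"
proof -
  have "c \<le> exp (c * real M)"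
    using assms exp_ge_add_one_self[of "c * real M"] mult_left_mono[of 1 "real M" c] by linarith
  moreover have "real M ^ 2 \<le> exp (real M) ^ 2"
    using exp_ge_add_one_self[of "real M"] by (intro power_mono) linarith+
  ultimately have "c * real M ^ 2 \<le> exp (c * real M) * exp (real M) ^ 2"
    using assms by (intro mult_mono) auto
  also have "\<dots> = exp ((c + 2) * real M)" by (simp add: power2_eq_square exp_add[symmetric] algebra_simps)
  finally show ?thesis .
qed

lemma nat_power_le_exp: "real (b ^ n) \<le> exp (real b * real n)"
proof -
  have "real b ^ n \<le> exp (real b) ^ n"
    using exp_ge_add_one_self[of "real b"] by (intro power_mono) linarith+
  then show ?thesis by (simp add: exp_of_nat_mult[symmetric] mult.commute)
qed

lemma real_two_three_power_le:
  "(2::real) ^ T * 3 ^ m \<le> exp (2 * real T + 3 * real m)"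
  using mult_mono[OF nat_power_le_exp[of 2 T] nat_power_le_exp[of 3 m]] by (simp add: exp_add)

text \<open>Precision is asked only at the nodes, which is what \<open>graph_subset_shell\<close>
  takes. The members are tame themselves so that the shells around them are thin.\<close>

definition tame_net :: "real \<Rightarrow> nat \<Rightarrow> 'd \<Rightarrow> (real ^ 'd \<Rightarrow> real) set \<Rightarrow> bool"
  where "tame_net C M i R \<longleftrightarrow> finite R \<and> R \<subseteq> {f. tame i f} \<and> real (card R) \<le> exp (C * real M ^ (CARD('d) - 1)) \<and>
    (\<forall>g. tame i g \<longrightarrow> (\<exists>f\<in>R. \<forall>k\<in>grid i (M + CARD('d)). \<bar>g (node M k) - f (node M k)\<bar> \<le> 1 / real M ^ 2))"

text \<open>A tame function is recorded by the rounded values on a grid. On each grid line in direction \<open>j0\<close>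
  these form a roughly convex sequence, so that a line costs only \<open>exp (O(M))\<close> possibilities.\<close>

lemma finite_net_tame:
  fixes i :: "'d::finite"
  assumes d: "CARD('d) \<ge> 2"
  shows "\<exists>C>0. \<forall>M\<ge>1. \<exists>R. tame_net C M i R"
proof -
  define D where "D = CARD('d)"
  have D: "D \<ge> 2" using d by (simp add: D_def)
  define e where "e = D - 2"
  have e: "D = e + 2" using D by (simp add: e_def)
  obtain j0 where j0: "j0 \<noteq> i"
    using d by (metis card_1_singleton_iff One_nat_def Suc_1 UNIV_eq_I not_less_eq_eq order_refl singleton_iff)
  \<comment> \<open>\<open>c * M ^ 2\<close> will bound \<open>2 * A + 1\<close>, \<open>C1\<close>
    is the exponential rate of a single grid line, and \<open>C\<close> accounts for the at most
    \<open>((2 * real D + 3) * real M) ^ e\<close> lines.\<close>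
  define c where "c = 2 * (2 * real D + real D * real (D + 1)) + 7"
  define C1 where "C1 = 2 * (c + 2) + 2 * (8 * real (D + 1) + 3) + 3 * (2 * real (D + 1))"
  define C where "C = C1 * (2 * real D + 3) ^ e"
  have c0: "c \<ge> 0" by (simp add: c_def)
  have C1: "C1 > 0" using c0 by (simp add: C1_def)
  have "C > 0" using C1 by (simp add: C_def add_pos_nonneg)
  show ?thesis
  proof (intro exI[of _ C] conjI allI impI \<open>C > 0\<close>)
    fix M :: nat assume M: "M \<ge> 1"
    define H where "H = M + D"
    define m where "m = 2 * H"
    \<comment> \<open>The bound of \<open>tame_bound\<close> for coordinates up to
      \<open>D + 2\<close>, in units of \<open>1 / M ^ 2\<close>; the extra 1 pays for the
      floor.\<close>
    define A where "A = M ^ 2 * (2 * D + 1 + D * (D + 1)) + 1"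
    define T where "T = 2 * M + 2 * m"
    define G where "G f k = \<lfloor>real M ^ 2 * f (node M k)\<rfloor>" for f :: "real ^ 'd \<Rightarrow> real" and k
    \<comment> \<open>One representative per grid line in direction \<open>j0\<close>. On its line
      the representative has position \<open>l = H\<close>.\<close>
    define B where "B = {b \<in> grid i H. b j0 \<in> {0::int}}"
    define \<Phi> where "\<Phi> f = restrict (\<lambda>b. restrict (\<lambda>l. G f (b(j0 := b j0 + (int l - int H)))) {..m}) B"
      for f :: "real ^ 'd \<Rightarrow> real"
    have H: "H \<le> (D + 1) * M" using M by (simp add: H_def add_mono)
    have finB: "finite B" unfolding B_def by (rule card_grid_slice(1)[OF j0]) simp
    have cardB: "card B \<le> (2 * H + 1) ^ e"
      using card_grid_slice(2)[OF j0, of "{0}" H] by (simp add: B_def e_def D_def)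
    have line: "restrict (\<lambda>l. G f (b(j0 := b j0 + (int l - int H)))) {..m} \<in> rough_convex m A T"
      if f: "tame i f" and b: "b \<in> B" for f b
    proof -
      define y where "y l = node M (b(j0 := b j0 + (int l - int H)))" for l
      define u where "u l = real M ^ 2 * f (y l)" for l
      have y: "y l = node M b + ((real l - real H) / real M) *\<^sub>R axis j0 1" for l
        unfolding y_def node_shift by simp
      have ysuc: "y (l + 1) = y l + (1 / real M) *\<^sub>R axis j0 1" for l
      proof -
        have "(real (l + 1) - real H) / real M = (real l - real H) / real M + 1 / real M"
          by (simp add: add_divide_distrib[symmetric])
        then show ?thesis unfolding y by (simp add: scaleR_add_left)
      qed
      have slope: "\<bar>u (l + 1) - u l\<bar> \<le> real M" for l
      proof -
        have "\<bar>f (y (l + 1)) - f (y l)\<bar> \<le> 1 / real M"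
          unfolding ysuc using tame_step[OF f, of "y l" "1 / real M" j0] by simp
        then have "real M ^ 2 * \<bar>f (y (l + 1)) - f (y l)\<bar> \<le> real M ^ 2 * (1 / real M)"
          by (intro mult_left_mono) auto
        also have "real M ^ 2 * \<bar>f (y (l + 1)) - f (y l)\<bar> = \<bar>u (l + 1) - u l\<bar>"
          by (simp add: u_def abs_mult right_diff_distrib[symmetric])
        also have "real M ^ 2 * (1 / real M) = real M" using M by (simp add: power2_eq_square)
        finally show ?thesis .
      qed
      have conv: "u (k + 1) - 2 * u k + u (k - 1) \<ge> 0" if "1 \<le> k" for k
      proof -
        have E: "y (k - 1) = y k - (1 / real M) *\<^sub>R axis j0 1"
          using ysuc[of "k - 1"] that by simp
        have "u (k + 1) - 2 * u k + u (k - 1) = real M ^ 2 * second_diff f (1 / real M) (y k) j0"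
          unfolding second_diff_def ysuc[symmetric] E[symmetric] by (simp add: u_def algebra_simps)
        then show ?thesis using tame_second_diff_nonneg[OF f] by simp
      qed
      have u0: "\<bar>u 0\<bar> \<le> real (M ^ 2 * (2 * D + 1 + D * (D + 1)))"
      proof -
        have "\<bar>y 0 $ j\<bar> \<le> real (D + 1) + 1" for j
        proof -
          have "\<bar>(b(j0 := b j0 + (int 0 - int H))) j\<bar> \<le> int H"
            using b by (auto simp: B_def grid_def)
          then have "\<bar>real_of_int ((b(j0 := b j0 + (int 0 - int H))) j)\<bar> \<le> real H" by linarith
          also have "\<dots> \<le> real ((D + 1) * M)" using H by (rule of_nat_mono)
          finally have "\<bar>real_of_int ((b(j0 := b j0 + (int 0 - int H))) j)\<bar> \<le> real (D + 1) * real M"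
            by (simp only: of_nat_mult)
          then have "\<bar>real_of_int ((b(j0 := b j0 + (int 0 - int H))) j)\<bar> / real M \<le> real (D + 1)"
            using M by (intro mult_imp_div_pos_le) auto
          then show ?thesis by (simp add: y_def node_def abs_divide)
        qed
        then have "\<bar>f (y 0)\<bar> \<le> real D + 1 + real D * (real (D + 1) + 1)"
          unfolding D_def by (rule tame_bound[OF f])
        then have "real M ^ 2 * \<bar>f (y 0)\<bar> \<le> real M ^ 2 * (real D + 1 + real D * (real (D + 1) + 1))"
          by (intro mult_left_mono) auto
        also have "\<dots> = real (M ^ 2 * (2 * D + 1 + D * (D + 1)))" by (simp add: algebra_simps)
        finally show ?thesis by (simp add: u_def abs_mult)
      qed
      have MA: "real M + 1 \<le> real A"
      proof -
        have "M * 1 \<le> M ^ 2 * (2 * D + 1 + D * (D + 1))"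
          using M unfolding power2_eq_square by (intro mult_mono) auto
        then have "M + 1 \<le> A" unfolding A_def by simp
        then show ?thesis by (metis of_nat_mono of_nat_add of_nat_1)
      qed
      have r0: "\<bar>\<lfloor>u 0\<rfloor>\<bar> \<le> int A" using u0 unfolding A_def by linarith
      have r1: "\<bar>\<lfloor>u 1\<rfloor> - \<lfloor>u 0\<rfloor>\<bar> \<le> int A" using slope[of 0] MA by (simp add: abs_le_iff) linarith
      have "m \<ge> 1" using D by (simp add: m_def H_def)
      then have "real_of_int (\<Sum>k\<in>{1..<m}. \<bar>\<lfloor>u (k + 1)\<rfloor> - 2 * \<lfloor>u k\<rfloor> + \<lfloor>u (k - 1)\<rfloor>\<bar>) \<le> 2 * real M + 2 * real m"
        by (intro sum_abs_second_diff_floor_le conv slope)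
      then have r2: "(\<Sum>k\<in>{1..<m}. \<bar>\<lfloor>u (k + 1)\<rfloor> - 2 * \<lfloor>u k\<rfloor> + \<lfloor>u (k - 1)\<rfloor>\<bar>) \<le> int T"
        unfolding T_def by linarith
      have eq: "restrict (\<lambda>l. G f (b(j0 := b j0 + (int l - int H)))) {..m} = restrict (\<lambda>l. \<lfloor>u l\<rfloor>) {..m}"
        by (simp add: G_def u_def y_def)
      have r2': "(\<Sum>k\<in>{1..<m}. \<bar>restrict (\<lambda>l. \<lfloor>u l\<rfloor>) {..m} (k + 1) - 2 * restrict (\<lambda>l. \<lfloor>u l\<rfloor>) {..m} k + restrict (\<lambda>l. \<lfloor>u l\<rfloor>) {..m} (k - 1)\<bar>)
          = (\<Sum>k\<in>{1..<m}. \<bar>\<lfloor>u (k + 1)\<rfloor> - 2 * \<lfloor>u k\<rfloor> + \<lfloor>u (k - 1)\<rfloor>\<bar>)"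
        by (intro sum.cong) auto
      show ?thesis
        unfolding eq rough_convex_def mem_Collect_eq r2' using r0 r1 r2 \<open>m \<ge> 1\<close>
        by (intro conjI restrict_PiE_iff[THEN iffD2]) auto
    qed
    let ?F = "{f. tame i f}"
    have m1: "m \<ge> 1" using D by (simp add: m_def H_def)
    have img: "\<Phi> ` ?F \<subseteq> PiE B (\<lambda>_. rough_convex m A T)"
      using line by (auto simp: \<Phi>_def)
    have finP: "finite (PiE B (\<lambda>_. rough_convex m A T))"
      using finB card_rough_convex_le(1)[OF m1] by (intro finite_PiE) auto
    \<comment> \<open>One tame function is kept for each table of rounded values that occurs. Two
      functions with the same table differ by at most one unit \<open>1 / M ^ 2\<close> at every
      node.\<close>
    define R where "R = inv_into ?F \<Phi> ` (\<Phi> ` ?F)"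
    have finI: "finite (\<Phi> ` ?F)" using finite_subset[OF img finP] .
    have "finite R" unfolding R_def using finI by blast
    have "R \<subseteq> ?F" unfolding R_def using inv_into_into[of _ \<Phi> ?F] by blast
    have cardL: "real (card (rough_convex m A T)) \<le> exp (C1 * real M)"
    proof -
      have Hr: "real H \<le> real (D + 1) * real M" using of_nat_mono[OF H, where 'a=real] by (simp only: of_nat_mult)
      have "real (2 * A + 1) = 2 * (2 * real D + 1 + real D * real (D + 1)) * real M ^ 2 + 3"
        by (simp add: A_def algebra_simps)
      also have "\<dots> \<le> c * real M ^ 2"
      proof -
        have "1 ^ 2 \<le> real M ^ 2" using M by (intro power_mono) auto
        then show ?thesis by (simp add: c_def algebra_simps)
      qed
      also have "\<dots> \<le> exp ((c + 2) * real M)" by (rule exp_bound_pow2[OF M c0])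
      finally have "real (2 * A + 1) ^ 2 \<le> exp ((c + 2) * real M) ^ 2" by (intro power_mono) auto
      then have a: "real (2 * A + 1) ^ 2 \<le> exp (2 * (c + 2) * real M)"
        by (simp add: power2_eq_square exp_add[symmetric] algebra_simps)
      have "2 * real T + 3 * real m \<le> (2 * (8 * real (D + 1) + 3) + 3 * (2 * real (D + 1))) * real M"
        using Hr unfolding T_def m_def by (simp add: algebra_simps)
      then have b: "(2::real) ^ T * 3 ^ m \<le> exp ((2 * (8 * real (D + 1) + 3) + 3 * (2 * real (D + 1))) * real M)"
        using real_two_three_power_le[of T m] by (meson exp_le_cancel_iff order_trans)
      have "real (card (rough_convex m A T)) \<le> real (2 * A + 1) ^ 2 * (2 ^ T * 3 ^ m)"
        by (rule card_rough_convex_le(2)[OF m1])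
      also have "\<dots> \<le> exp (2 * (c + 2) * real M) * exp ((2 * (8 * real (D + 1) + 3) + 3 * (2 * real (D + 1))) * real M)"
        by (intro mult_mono a b) auto
      also have "\<dots> = exp (C1 * real M)"
        unfolding C1_def by (simp add: exp_add[symmetric] distrib_right)
      finally show ?thesis .
    qed
    have "card R \<le> card (\<Phi> ` ?F)" unfolding R_def by (rule card_image_le[OF finI])
    also have "\<dots> \<le> card (PiE B (\<lambda>_. rough_convex m A T))" by (rule card_mono[OF finP img])
    also have "\<dots> = card (rough_convex m A T) ^ card B" using finB by (simp add: card_PiE)
    finally have "real (card R) \<le> real (card (rough_convex m A T)) ^ card B"
      by (metis of_nat_le_iff of_nat_power)
    also have "\<dots> \<le> exp (C1 * real M) ^ card B" by (intro power_mono cardL) auto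
    also have "\<dots> = exp (real (card B) * (C1 * real M))" by (rule exp_of_nat_mult[symmetric])
    also have "\<dots> \<le> exp (C * real M ^ (e + 1))"
    proof -
      have "real (card B) \<le> (2 * real H + 1) ^ e"
        using of_nat_mono[OF cardB, where 'a=real] by (simp add: add.commute)
      also have "\<dots> \<le> ((2 * real D + 3) * real M) ^ e"
      proof (intro power_mono)
        have "real D * 1 \<le> real D * real M" using M by (intro mult_left_mono) auto
        moreover have "1 \<le> real M" using M by simp
        ultimately show "2 * real H + 1 \<le> (2 * real D + 3) * real M"
          unfolding H_def of_nat_add distrib_right mult.assoc by (smt (verit))
      qed simp
      finally have "real (card B) * (C1 * real M) \<le> ((2 * real D + 3) * real M) ^ e * (C1 * real M)"
        using C1 by (intro mult_right_mono) auto
      then show ?thesis by (simp add: C_def power_mult_distrib mult_ac)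
    qed
    also have "e + 1 = CARD('d) - 1" using e by (simp add: D_def)
    finally have cardR: "real (card R) \<le> exp (C * real M ^ (CARD('d) - 1))" .
    have net: "\<exists>f\<in>R. \<forall>k\<in>grid i (M + CARD('d)). \<bar>g (node M k) - f (node M k)\<bar> \<le> 1 / real M ^ 2"
      if g: "tame i g" for g
    proof
      let ?f = "inv_into ?F \<Phi> (\<Phi> g)"
      show "?f \<in> R" unfolding R_def using g by blast
      have eq: "\<Phi> ?f = \<Phi> g" using f_inv_into_f[of "\<Phi> g" \<Phi> ?F] g by blast
      show "\<forall>k\<in>grid i (M + CARD('d)). \<bar>g (node M k) - ?f (node M k)\<bar> \<le> 1 / real M ^ 2"
      proof
        fix k assume k: "k \<in> grid i (M + CARD('d))"
        define b where "b = k(j0 := 0)"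
        define l where "l = nat (k j0 + int H)"
        have kj: "\<bar>k j0\<bar> \<le> int H" using k by (simp add: grid_def H_def D_def)
        have b: "b \<in> B" using k j0 by (auto simp: b_def B_def grid_def H_def D_def)
        have l: "l \<in> {..m}" "int l = k j0 + int H" using kj by (auto simp: l_def m_def)
        have kb: "b(j0 := b j0 + (int l - int H)) = k" using l by (auto simp: b_def)
        have "\<Phi> ?f b l = \<Phi> g b l" by (simp only: eq)
        then have "\<lfloor>real M ^ 2 * ?f (node M k)\<rfloor> = \<lfloor>real M ^ 2 * g (node M k)\<rfloor>"
          using b l kb by (simp add: \<Phi>_def G_def)
        then have "\<bar>real M ^ 2 * g (node M k) - real M ^ 2 * ?f (node M k)\<bar> \<le> 1"
          by linarith
        then have "real M ^ 2 * \<bar>g (node M k) - ?f (node M k)\<bar> \<le> 1"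
          by (simp add: right_diff_distrib[symmetric] abs_mult)
        then show "\<bar>g (node M k) - ?f (node M k)\<bar> \<le> 1 / real M ^ 2"
          using M by (simp add: pos_le_divide_eq mult.commute)
      qed
    qed
    show "\<exists>R. tame_net C M i R"
      unfolding tame_net_def using \<open>finite R\<close> \<open>R \<subseteq> ?F\<close> cardR net by blast
  qed
qed

section \<open>Covering convex independent sets\<close>

text \<open>A convex set without interior lies in a hyperplane, whose normal supports trivially;
  this covers polytopes with few vertices. Otherwise an extreme point is a boundary point and has a
  supporting hyperplane.\<close>

lemma extreme_point_supporting_normal:
  fixes K :: "'a::euclidean_space set"
  assumes "convex K" "v extreme_point_of K"
  obtains u where "u \<noteq> 0" "\<And>x. x \<in> K \<Longrightarrow> u \<bullet> x \<le> u \<bullet> v"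
proof (cases "interior K = {}")
  case True
  then obtain a b where "a \<noteq> 0" "K \<subseteq> {x. a \<bullet> x = b}"
    using empty_interior_subset_hyperplane[OF assms(1)] by blast
  moreover have "v \<in> K" using assms(2) by (simp add: extreme_point_of_def)
  ultimately have "a \<bullet> x \<le> a \<bullet> v" if "x \<in> K" for x
    using that by (metis (mono_tags, lifting) mem_Collect_eq order_refl subsetD)
  then show ?thesis using that[of a] \<open>a \<noteq> 0\<close> by blast
next
  case False
  then have "rel_interior K = interior K" using rel_interior_nonempty_interior by blast
  then have "v \<notin> rel_interior K" using extreme_point_not_in_interior[OF assms(2)] by simp
  moreover have "v \<in> K" using assms(2) by (simp add: extreme_point_of_def)
  ultimately obtain a where "a \<noteq> 0" "\<And>y. y \<in> K \<Longrightarrow> a \<bullet> v \<le> a \<bullet> y"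
    using supporting_hyperplane_rel_boundary[OF assms(1)] by metis
  then show ?thesis using that[of "- a"] by simp
qed

text \<open>Dividing the normal by its largest coordinate turns the supporting half-space into a lower
  (\<open>\<sigma> = 1\<close>) or upper (\<open>\<sigma> = -1\<close>) linear bound whose slopes are at most \<open>1\<close>.\<close>

lemma supporting_slope:
  fixes u q :: "real ^ 'd"
  assumes "u \<noteq> 0" and supp: "\<And>x. x \<in> Q \<Longrightarrow> u \<bullet> x \<le> u \<bullet> q"
  obtains i \<sigma> w where "\<sigma> = 1 \<or> \<sigma> = -1" "w $ i = 0" "\<And>j. \<bar>w $ j\<bar> \<le> 1"
    "\<And>x. x \<in> Q \<Longrightarrow> \<sigma> * q $ i + w \<bullet> (x - q) \<le> \<sigma> * x $ i"
proof -
  obtain i where i: "\<And>j. \<bar>u $ j\<bar> \<le> \<bar>u $ i\<bar>"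
  proof -
    have "\<exists>i\<in>UNIV. \<forall>j\<in>UNIV. \<bar>u $ j\<bar> \<le> \<bar>u $ i\<bar>"
    proof -
      let ?S = "range (\<lambda>j. \<bar>u $ j\<bar>)"
      have "Max ?S \<in> ?S" by (intro Max_in) auto
      then obtain i where i: "Max ?S = \<bar>u $ i\<bar>" by blast
      have "\<bar>u $ j\<bar> \<le> \<bar>u $ i\<bar>" for j unfolding i[symmetric] by (intro Max_ge) auto
      then show ?thesis by blast
    qed
    then show ?thesis using that by blast
  qed
  have u: "\<bar>u $ i\<bar> > 0"
  proof (rule ccontr)
    assume "\<not> \<bar>u $ i\<bar> > 0"
    then have "u $ j = 0" for j using i[of j] by simp
    then show False using assms(1) by (simp add: vec_eq_iff)
  qed
  define \<sigma> where "\<sigma> = - sgn (u $ i)"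
  define w where "w = (\<chi> j. if j = i then 0 else u $ j / \<bar>u $ i\<bar>)"
  show ?thesis
  proof (rule that[of \<sigma> w i])
    show "\<sigma> = 1 \<or> \<sigma> = -1" using u by (auto simp: \<sigma>_def sgn_if)
    show wi: "w $ i = 0" by (simp add: w_def)
    show "\<bar>w $ j\<bar> \<le> 1" for j using i[of j] u by (simp add: w_def abs_divide divide_le_eq)
    fix x assume "x \<in> Q"
    have "u \<bullet> (x - q) = u $ i * (x - q) $ i + (\<Sum>j\<in>-{i}. u $ j * (x - q) $ j)"
      unfolding inner_vec_def inner_real_def by (subst sum.remove[of _ i]) (auto simp: Compl_eq_Diff_UNIV)
    also have "(\<Sum>j\<in>-{i}. u $ j * (x - q) $ j) = \<bar>u $ i\<bar> * (w \<bullet> (x - q))"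
      unfolding inner_off_coordinate[OF wi] sum_distrib_left using u
      by (intro sum.cong) (auto simp: w_def)
    also have "u $ i * (x - q) $ i = - (\<bar>u $ i\<bar> * (\<sigma> * (x - q) $ i))"
      using mult_sgn_abs[of "u $ i"] by (simp add: \<sigma>_def mult.assoc[symmetric] mult.commute)
    finally have "\<bar>u $ i\<bar> * (w \<bullet> (x - q)) \<le> \<bar>u $ i\<bar> * (\<sigma> * (x - q) $ i)"
      using supp[OF \<open>x \<in> Q\<close>] by (simp add: inner_diff_right)
    then have "w \<bullet> (x - q) \<le> \<sigma> * (x - q) $ i" using u by simp
    then show "\<sigma> * q $ i + w \<bullet> (x - q) \<le> \<sigma> * x $ i" by (simp add: algebra_simps)
  qed
qed

text \<open>The maximum of the affine functions through the points is convex with slopes at most 1.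
  By \<open>supp\<close> none of them exceeds the prescribed value at another point of
  \<open>Q\<close>.\<close>

lemma tame_envelope:
  fixes Q :: "(real ^ 'd) set"
  assumes fin: "finite Q" and ball: "Q \<subseteq> cball 0 1" and \<sigma>: "\<sigma> = 1 \<or> \<sigma> = -1"
    and w: "\<And>q. q \<in> Q \<Longrightarrow> w q $ i = 0" "\<And>q j. q \<in> Q \<Longrightarrow> \<bar>w q $ j\<bar> \<le> 1"
    and supp: "\<And>q x. q \<in> Q \<Longrightarrow> x \<in> Q \<Longrightarrow> \<sigma> * q $ i + w q \<bullet> (x - q) \<le> \<sigma> * x $ i"
  shows "\<exists>f. tame i f \<and> (\<forall>q\<in>Q. f q = \<sigma> * q $ i)"
proof (cases "Q = {}")
  case True
  have "tame i (\<lambda>_. 0)" unfolding tame_def subgradient_def by (auto intro!: exI[of _ 0])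
  then show ?thesis using True by blast
next
  case False
  define L where "L q x = \<sigma> * q $ i + w q \<bullet> (x - q)" for q x
  define f where "f x = Max ((\<lambda>q. L q x) ` Q)" for x
  have ge: "L q x \<le> f x" if "q \<in> Q" for q x
    unfolding f_def using fin that by (intro Max_ge) auto
  have att: "\<exists>q\<in>Q. f x = L q x" for x
  proof -
    have "f x \<in> (\<lambda>q. L q x) ` Q" unfolding f_def using fin False by (intro Max_in) auto
    then show ?thesis by blast
  qed
  have val: "f q = \<sigma> * q $ i" if "q \<in> Q" for q
  proof (rule antisym)
    obtain p where "p \<in> Q" "f q = L p q" using att by blast
    then show "f q \<le> \<sigma> * q $ i" using supp[of p q] that by (simp add: L_def)
    show "\<sigma> * q $ i \<le> f q" using ge[OF that, of q] by (simp add: L_def)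
  qed
  have sub: "\<exists>s. subgradient i f z s" for z
  proof -
    obtain q where q: "q \<in> Q" "f z = L q z" using att by blast
    have "f z + w q \<bullet> (x - z) \<le> f x" for x
      using ge[OF q(1), of x] q(2) by (simp add: L_def inner_diff_right)
    then have "subgradient i f z (w q)" using w q(1) by (simp add: subgradient_def)
    then show ?thesis by blast
  qed
  have "\<bar>f 0\<bar> \<le> real CARD('d) + 1"
  proof -
    obtain q where q: "q \<in> Q" "f 0 = L q 0" using att by blast
    have qj: "\<bar>q $ j\<bar> \<le> 1" for j using component_le_norm_cart[of q j] q(1) ball by auto
    have "\<bar>w q \<bullet> q\<bar> \<le> (\<Sum>j\<in>UNIV. \<bar>q $ j\<bar>)" using inner_le_sum_abs w(2)[OF q(1)] by blast
    also have "\<dots> \<le> (\<Sum>j\<in>(UNIV::'d set). 1)" using qj by (intro sum_mono)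
    finally have "\<bar>w q \<bullet> q\<bar> \<le> real CARD('d)" by simp
    moreover have "f 0 = \<sigma> * q $ i - w q \<bullet> q" using q(2) by (simp add: L_def)
    moreover have "\<bar>\<sigma> * q $ i\<bar> \<le> 1" using \<sigma> qj[of i] by auto
    ultimately show ?thesis by linarith
  qed
  then have "tame i f" using sub by (simp add: tame_def)
  then show ?thesis using val by blast
qed

text \<open>One family has to serve all sets \<open>Q\<close>, so that it is known before any point
  is chosen. The number \<open>2 * CARD('d)\<close> stands for one shell per coordinate and
  sign.\<close>

definition shell_cover :: "real \<Rightarrow> nat \<Rightarrow> (real ^ 'd) set set \<Rightarrow> bool"
  where "shell_cover C M F \<longleftrightarrow> finite F \<and> real (card F) \<le> exp (C * real M ^ (CARD('d) - 1)) \<and>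
    (\<forall>S\<in>F. S \<in> lmeasurable \<and> measure lebesgue S \<le> C / real M ^ 2) \<and>
    (\<forall>Q. finite Q \<and> Q \<subseteq> cball 0 1 \<and> convex_independent Q \<longrightarrow>
       (\<exists>G\<subseteq>F. card G \<le> 2 * CARD('d) \<and> Q \<subseteq> \<Union>G))"

text \<open>Every vertex has a supporting slope for some coordinate \<open>i\<close> and sign
  \<open>\<sigma>\<close>. The vertices sharing such a pair lie on the graph of one tame function,
  hence in the shell of a nearby member of the net.\<close>

lemma shells_cover_convex_independent:
  assumes d: "CARD('d::finite) \<ge> 2"
  shows "\<exists>C>0. \<forall>M\<ge>1. \<exists>F :: (real ^ 'd) set set. shell_cover C M F"
proof -
  have "\<forall>i::'d. \<exists>C>0. \<forall>M\<ge>1. \<exists>R. tame_net C M i R"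
    using finite_net_tame[OF d] by blast
  then obtain C0 where C0: "\<And>i::'d. C0 i > 0" "\<And>i M. M \<ge> 1 \<Longrightarrow> \<exists>R. tame_net (C0 i) M i R"
    by metis
  define D where "D = real CARD('d)"
  define C1 where "C1 = (\<Sum>i\<in>UNIV. C0 i)"
  define C where "C = C1 + 2 * D + 55 * D ^ 3 * 3 ^ CARD('d)"
  have C01: "C0 i \<le> C1" for i unfolding C1_def using C0(1) by (intro member_le_sum) (auto intro: less_imp_le)
  have D: "D \<ge> 2" using d by (simp add: D_def)
  have C1: "C1 > 0" using C01 C0(1) by (meson less_le_trans)
  have C: "C > 0" "C \<ge> C1 + 2 * D" "C \<ge> 55 * D ^ 3 * 3 ^ CARD('d)" using C1 D by (auto simp: C_def add_pos_nonneg)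
  show ?thesis
  proof (intro exI[of _ C] conjI allI impI \<open>C > 0\<close>)
    fix M :: nat assume M: "M \<ge> 1"
    obtain R where R: "\<And>i. tame_net (C0 i) M i (R i)" using C0(2)[OF M] by metis
    define I where "I = {(i::'d, \<sigma>::real). \<sigma> = 1 \<or> \<sigma> = -1}"
    have Ieq: "I = UNIV \<times> {1, -1}" by (auto simp: I_def)
    have I: "finite I" "card I = 2 * CARD('d)" unfolding Ieq by (auto simp: card_cartesian_product)
    define F where "F = (\<Union>(i, \<sigma>)\<in>I. shell \<sigma> M i ` R i)"
    have finR: "finite (R i)" for i using R[of i] by (simp add: tame_net_def)
    have "finite F" unfolding F_def using I finR by auto
    have p1: "1 \<le> real M ^ (CARD('d) - 1)" using M by simp
    have cR: "real (card (R i)) \<le> exp (C1 * real M ^ (CARD('d) - 1))" for i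
    proof -
      have "real (card (R i)) \<le> exp (C0 i * real M ^ (CARD('d) - 1))" using R[of i] by (simp add: tame_net_def)
      also have "\<dots> \<le> exp (C1 * real M ^ (CARD('d) - 1))" using C01[of i] p1 by (simp add: mult_right_mono)
      finally show ?thesis .
    qed
    have "card F \<le> (\<Sum>(i, \<sigma>)\<in>I. card (shell \<sigma> M i ` R i))"
      unfolding F_def using card_UN_le[OF I(1), of "\<lambda>(i, \<sigma>). shell \<sigma> M i ` R i"]
      by (simp add: case_prod_unfold)
    also have "\<dots> \<le> (\<Sum>(i, \<sigma>)\<in>I. card (R i))"
      by (intro sum_mono) (auto intro: card_image_le finR)
    finally have "real (card F) \<le> (\<Sum>(i, \<sigma>)\<in>I. real (card (R i)))"
      by (simp add: case_prod_unfold flip: of_nat_sum)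
    also have "\<dots> \<le> (\<Sum>(i, \<sigma>)\<in>I. exp (C1 * real M ^ (CARD('d) - 1)))"
      by (intro sum_mono) (use cR in \<open>simp add: case_prod_unfold\<close>)
    also have "\<dots> = 2 * D * exp (C1 * real M ^ (CARD('d) - 1))"
      by (simp add: I D_def case_prod_unfold)
    also have "\<dots> \<le> exp (2 * D * real M ^ (CARD('d) - 1)) * exp (C1 * real M ^ (CARD('d) - 1))"
    proof (rule mult_right_mono)
      have "2 * D \<le> 2 * D * real M ^ (CARD('d) - 1)" using p1 D by (simp add: mult_le_cancel_left1)
      also have "\<dots> \<le> exp (2 * D * real M ^ (CARD('d) - 1))"
        using exp_ge_add_one_self[of "2 * D * real M ^ (CARD('d) - 1)"] by linarith
      finally show "2 * D \<le> exp (2 * D * real M ^ (CARD('d) - 1))" .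
    qed simp
    also have "\<dots> = exp ((C1 + 2 * D) * real M ^ (CARD('d) - 1))"
      by (simp add: exp_add[symmetric] algebra_simps)
    also have "\<dots> \<le> exp (C * real M ^ (CARD('d) - 1))"
      using C(2) p1 by (simp add: mult_right_mono)
    finally have cF: "real (card F) \<le> exp (C * real M ^ (CARD('d) - 1))" .
    have mF: "S \<in> lmeasurable \<and> measure lebesgue S \<le> C / real M ^ 2" if S: "S \<in> F" for S
    proof -
      obtain p where p: "p \<in> I" "S \<in> shell (snd p) M (fst p) ` R (fst p)"
        using S unfolding F_def case_prod_unfold by blast
      define i \<sigma> where "i = fst p" and "\<sigma> = snd p"
      obtain f where f: "\<sigma> = 1 \<or> \<sigma> = -1" "f \<in> R i" "S = shell \<sigma> M i f"
        using p unfolding i_def \<sigma>_def by (auto simp: I_def)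
      have tf: "tame i f" using f(2) R[of i] by (auto simp: tame_net_def)
      have "55 * D ^ 3 * 3 ^ CARD('d) / real M ^ 2 \<le> C / real M ^ 2"
        using C(3) by (intro divide_right_mono) auto
      then show ?thesis using measure_shell[OF tf f(1) M d] unfolding f(3) D_def by linarith
    qed
    have cov: "\<exists>G\<subseteq>F. card G \<le> 2 * CARD('d) \<and> Q \<subseteq> \<Union>G"
      if Q: "finite Q" "Q \<subseteq> cball 0 1" "convex_independent Q" for Q
    proof -
      obtain K where K: "polytope K" "Q = {v. v extreme_point_of K}"
        using Q(3) by (auto simp: convex_independent_def)
      have QK: "Q \<subseteq> K" using K(2) by (auto simp: extreme_point_of_def)
      define good where "good q i \<sigma> w \<longleftrightarrow> (\<sigma> = 1 \<or> \<sigma> = -1) \<and> w $ i = 0 \<and> (\<forall>j. \<bar>w $ j\<bar> \<le> 1) \<and>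
        (\<forall>x\<in>Q. \<sigma> * q $ i + w \<bullet> (x - q) \<le> \<sigma> * x $ i)" for q i \<sigma> and w :: "real ^ 'd"
      have ex: "\<exists>i \<sigma> w. good q i \<sigma> w" if "q \<in> Q" for q
      proof -
        have "q extreme_point_of K" using that K(2) by simp
        then obtain u where u: "u \<noteq> 0" "\<And>x. x \<in> K \<Longrightarrow> u \<bullet> x \<le> u \<bullet> q"
          using extreme_point_supporting_normal[OF polytope_imp_convex[OF K(1)]] by metis
        have uQ: "u \<bullet> x \<le> u \<bullet> q" if "x \<in> Q" for x using u(2) QK that by blast
        show ?thesis unfolding good_def
          by (rule supporting_slope[OF u(1) uQ], assumption) (intro exI conjI allI ballI; assumption)
      qed
      have "\<exists>S\<in>F. {q\<in>Q. \<exists>w. good q i \<sigma> w} \<subseteq> S" if "(i, \<sigma>) \<in> I" for i \<sigma>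
      proof -
        let ?Q = "{q\<in>Q. \<exists>w. good q i \<sigma> w}"
        have \<sigma>: "\<sigma> = 1 \<or> \<sigma> = -1" using that by (simp add: I_def)
        define w where "w q = (SOME w. good q i \<sigma> w)" for q
        have w: "good q i \<sigma> (w q)" if "q \<in> ?Q" for q
          using that someI_ex[of "good q i \<sigma>"] unfolding w_def by blast
        have "\<exists>g. tame i g \<and> (\<forall>q\<in>?Q. g q = \<sigma> * q $ i)"
        proof (rule tame_envelope[where w = w])
          show "finite ?Q" "?Q \<subseteq> cball 0 1" "\<sigma> = 1 \<or> \<sigma> = -1" using Q \<sigma> by auto
        qed (use w in \<open>auto simp: good_def\<close>)
        then obtain g where g: "tame i g" "\<And>q. q \<in> ?Q \<Longrightarrow> g q = \<sigma> * q $ i" by blast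
        obtain f where f: "f \<in> R i" "\<And>k. k \<in> grid i (M + CARD('d)) \<Longrightarrow> \<bar>g (node M k) - f (node M k)\<bar> \<le> 1 / real M ^ 2"
          using R[of i] g(1) unfolding tame_net_def by blast
        have tf: "tame i f" using f(1) R[of i] by (auto simp: tame_net_def)
        have "?Q \<subseteq> shell \<sigma> M i f"
          using graph_subset_shell[OF tf g(1) M f(2)] g(2) Q(2) by blast
        moreover have "shell \<sigma> M i f \<in> F" unfolding F_def using that f(1) by blast
        ultimately show ?thesis by blast
      qed
      then have "\<forall>p\<in>I. \<exists>S. S \<in> F \<and> {q\<in>Q. \<exists>w. good q (fst p) (snd p) w} \<subseteq> S"
        by (metis prod.collapse)
      from bchoice[OF this] obtain S where
        S: "\<And>p. p \<in> I \<Longrightarrow> S p \<in> F" "\<And>p. p \<in> I \<Longrightarrow> {q\<in>Q. \<exists>w. good q (fst p) (snd p) w} \<subseteq> S p"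
        by blast
      have "Q \<subseteq> \<Union>(S ` I)"
      proof
        fix q assume "q \<in> Q"
        then obtain i \<sigma> w where g: "good q i \<sigma> w" using ex by blast
        then have "(i, \<sigma>) \<in> I" by (simp add: good_def I_def)
        then show "q \<in> \<Union>(S ` I)" using S(2)[of "(i, \<sigma>)"] g \<open>q \<in> Q\<close> by auto
      qed
      moreover have "card (S ` I) \<le> 2 * CARD('d)" using card_image_le[OF I(1), of S] I(2) by simp
      moreover have "S ` I \<subseteq> F" using S(1) by blast
      ultimately show ?thesis by blast
    qed
    show "\<exists>F :: (real ^ 'd) set set. shell_cover C M F"
      unfolding shell_cover_def
    proof (rule exI[of _ F], intro conjI ballI allI impI)
      fix Q :: "(real ^ 'd) set" assume "finite Q \<and> Q \<subseteq> cball 0 1 \<and> convex_independent Q"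
      then show "\<exists>G\<subseteq>F. card G \<le> 2 * CARD('d) \<and> Q \<subseteq> \<Union>G" using cov by simp
    qed (use \<open>finite F\<close> cF mF in simp_all)
  qed
qed

section \<open>Greedy choice of points\<close>

text \<open>Smaller subsets are included so that the property can be carried along from the empty
  set: a new point only has to avoid the affine hulls of at most \<open>DIM('a)\<close> old
  points.\<close>

definition generic :: "'a::euclidean_space set \<Rightarrow> bool"
  where "generic P \<longleftrightarrow> (\<forall>T\<subseteq>P. card T \<le> DIM('a) + 1 \<longrightarrow> \<not> affine_dependent T)"

lemma generic_imp_general_position:
  fixes P :: "'a::euclidean_space set"
  assumes "generic P"
  shows "general_position P"
  unfolding general_position_def
proof safe
  fix S and a :: 'a and b
  assume S: "S \<subseteq> P" "card S = DIM('a) + 1" "a \<noteq> 0" "S \<subseteq> {x. a \<bullet> x = b}"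
  have "\<not> affine_dependent S" using assms S unfolding generic_def by simp
  from aff_dim_affine_independent[OF this] S(2) have "aff_dim S = DIM('a)" by simp
  moreover have "aff_dim S \<le> aff_dim {x. a \<bullet> x = b}" by (rule aff_dim_subset[OF S(4)])
  ultimately show False using S(3) by simp
qed

lemma generic_insert:
  fixes P :: "'a::euclidean_space set"
  assumes P: "finite P" "generic P"
    and x: "x \<notin> (\<Union>T\<in>{T. T \<subseteq> P \<and> card T \<le> DIM('a)}. affine hull T)"
  shows "generic (insert x P)"
  unfolding generic_def
proof (intro allI impI)
  fix T assume T: "T \<subseteq> insert x P" "card T \<le> DIM('a) + 1"
  show "\<not> affine_dependent T"
  proof (cases "x \<in> T")
    case False
    then show ?thesis using T P(2) unfolding generic_def by blast
  next
    case True
    have fin: "finite T" using T(1) P(1) finite_subset by blast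
    have sub: "T - {x} \<subseteq> P" and c: "card (T - {x}) \<le> DIM('a)"
      using T True fin by (auto simp: card_Diff_singleton)
    have "\<not> affine_dependent (T - {x})" using P(2) sub c unfolding generic_def by auto
    moreover have "x \<notin> affine hull (T - {x})" using x sub c by blast
    ultimately have "\<not> affine_dependent (insert x (T - {x}))" by (rule affine_independent_insert)
    then show ?thesis using True by (simp add: insert_absorb)
  qed
qed

text \<open>At most \<open>DIM('a)\<close> points span an affine set of deficient dimension, which
  is convex without interior.\<close>

lemma negligible_small_hulls:
  fixes P :: "'a::euclidean_space set"
  assumes "finite P"
  shows "negligible (\<Union>T\<in>{T. T \<subseteq> P \<and> card T \<le> DIM('a)}. affine hull T)"
proof (rule negligible_Union)
  show "finite ((hull) affine ` {T. T \<subseteq> P \<and> card T \<le> DIM('a)})" using assms by simp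
  fix H assume "H \<in> (hull) affine ` {T. T \<subseteq> P \<and> card T \<le> DIM('a)}"
  then obtain T where T: "T \<subseteq> P" "card T \<le> DIM('a)" "H = affine hull T" by blast
  have "finite T" using T(1) assms finite_subset by blast
  then have "aff_dim H < DIM('a)" using aff_dim_le_card[of T] T(2,3) by (simp add: aff_dim_affine_hull)
  then have "interior H = {}" using low_dim_interior[of H] by simp
  then show "negligible H"
    using negligible_convex_interior[of H] by (simp add: T(3) affine_imp_convex affine_affine_hull)
qed

text \<open>Ensures that a point outside all small hulls is a new one.\<close>

lemma subset_small_hulls:
  fixes P :: "'a::euclidean_space set"
  shows "P \<subseteq> (\<Union>T\<in>{T. T \<subseteq> P \<and> card T \<le> DIM('a)}. affine hull T)"
proof
  fix x assume "x \<in> P"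
  then have "{x} \<subseteq> P" "card {x} \<le> DIM('a)" "x \<in> affine hull {x}" by (auto simp: hull_inc Suc_leI)
  then show "x \<in> (\<Union>T\<in>{T. T \<subseteq> P \<and> card T \<le> DIM('a)}. affine hull T)" by blast
qed

text \<open>An exponential potential: a single shell with many points already makes the sum large,
  so a bound on the weight bounds all shells at once.\<close>

definition weight :: "'a set set \<Rightarrow> 'a set \<Rightarrow> real"
  where "weight F P = (\<Sum>S\<in>F. 2 ^ card (P \<inter> S))"

lemma weight_empty [simp]: "weight F {} = card F"
  by (simp add: weight_def)

text \<open>On average over \<open>A\<close> a new point multiplies the weight by at most \<open>1 + \<sigma> / v\<close>; the factor
  \<open>2\<close> below avoids a strict comparison of integrals.\<close>

lemma low_weight_point:
  fixes A :: "'a::euclidean_space set"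
  assumes F: "finite F" "\<And>S. S \<in> F \<Longrightarrow> S \<in> lmeasurable" "\<And>S. S \<in> F \<Longrightarrow> measure lebesgue S \<le> \<sigma>"
    and "\<sigma> > 0" and A: "A \<in> lmeasurable" "measure lebesgue A \<ge> v" and "v > 0"
    and N: "negligible N" and P: "finite P"
  shows "\<exists>x\<in>A - N. weight F (insert x P) \<le> (1 + 2 * \<sigma> / v) * weight F P"
proof (rule ccontr)
  assume contra: "\<not> ?thesis"
  define B where "B = A - N"
  have nN: "N \<in> null_sets lebesgue" using N by (simp add: negligible_iff_null_sets)
  then have "B \<in> lmeasurable" unfolding B_def using A(1) by (intro fmeasurable_Diff) auto
  note B = this
  have mB: "measure lebesgue B = measure lebesgue A"
    unfolding B_def using A(1) nN by (intro measure_Diff_null_set) auto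
  define w where "w S = (2::real) ^ card (P \<inter> S)" for S
  define W where "W = weight F P"
  define c where "c = 2 * \<sigma> / v * W"
  have w0: "w S \<ge> 0" for S by (simp add: w_def)
  have W: "W = (\<Sum>S\<in>F. w S)" by (simp add: W_def weight_def w_def)
  have ins: "weight F (insert x P) \<le> W + (\<Sum>S\<in>F. w S * indicator S x)" for x
  proof -
    have "(2::real) ^ card (insert x P \<inter> S) \<le> w S + w S * indicator S x" for S
    proof (cases "x \<in> S")
      case True
      then have "card (insert x P \<inter> S) \<le> Suc (card (P \<inter> S))" using P by (simp add: card_insert_if)
      then have "(2::real) ^ card (insert x P \<inter> S) \<le> 2 ^ Suc (card (P \<inter> S))"
        by (intro power_increasing) auto
      then show ?thesis using True by (simp add: w_def)
    qed (simp add: w_def)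
    then show ?thesis unfolding weight_def W sum.distrib[symmetric] by (intro sum_mono)
  qed
  \<comment> \<open>If every point of \<open>B\<close> were bad, the weight added would be at least
    \<open>c\<close> throughout \<open>B\<close>. Integrating over \<open>B\<close> is to contradict
    the volume bound \<open>\<sigma>\<close> of the sets in \<open>F\<close>.\<close>
  have gt: "c \<le> (\<Sum>S\<in>F. w S * indicator S x)" if "x \<in> B" for x
  proof -
    have "\<not> weight F (insert x P) \<le> (1 + 2 * \<sigma> / v) * W"
      using contra that by (auto simp: B_def W_def)
    then show ?thesis using ins[of x] by (simp add: c_def distrib_right)
  qed
  have int: "integrable lebesgue (indicator X :: 'a \<Rightarrow> real)" if "X \<in> lmeasurable" for X
    using that by (simp add: integrable_indicator_iff fmeasurable_def del: emeasure_completion)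
  have SB: "S \<inter> B \<in> lmeasurable" if "S \<in> F" for S using F(2)[OF that] B by (intro fmeasurable.Int) 
  have "c * measure lebesgue B = (\<integral>x. c * indicator B x \<partial>lebesgue)" by simp
  also have "\<dots> \<le> (\<integral>x. (\<Sum>S\<in>F. w S * indicator (S \<inter> B) x) \<partial>lebesgue)"
  proof (rule integral_mono)
    show "integrable lebesgue (\<lambda>x. c * indicator B x)" using int[OF B] by simp
    show "integrable lebesgue (\<lambda>x. \<Sum>S\<in>F. w S * indicator (S \<inter> B) x)"
      using int[OF SB] by (intro Bochner_Integration.integrable_sum integrable_mult_right) auto
    show "c * indicator B x \<le> (\<Sum>S\<in>F. w S * indicator (S \<inter> B) x)" for x
      using gt[of x] by (cases "x \<in> B") (auto simp: indicator_inter_arith)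
  qed
  also have "\<dots> = (\<Sum>S\<in>F. w S * measure lebesgue (S \<inter> B))"
    using int[OF SB] by (subst Bochner_Integration.integral_sum) auto
  also have "\<dots> \<le> (\<Sum>S\<in>F. w S * \<sigma>)"
  proof (intro sum_mono mult_left_mono w0)
    fix S assume S: "S \<in> F"
    have "measure lebesgue (S \<inter> B) \<le> measure lebesgue S"
      using F(2)[OF S] SB[OF S] by (intro measure_mono_fmeasurable) auto
    then show "measure lebesgue (S \<inter> B) \<le> \<sigma>" using F(3)[OF S] by simp
  qed
  also have "\<dots> = W * \<sigma>" by (simp add: W sum_distrib_right)
  finally have 1: "c * measure lebesgue B \<le> W * \<sigma>" .
  have "W \<ge> 0" unfolding W using w0 by (intro sum_nonneg)
  then have "c \<ge> 0" using \<open>\<sigma> > 0\<close> \<open>v > 0\<close> by (simp add: c_def)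
  then have "c * v \<le> c * measure lebesgue B" using A(2) mB by (intro mult_left_mono) auto
  also have "c * v = 2 * \<sigma> * W" using \<open>v > 0\<close> by (simp add: c_def)
  \<comment> \<open>The two bounds leave only \<open>W = 0\<close>, hence \<open>F = {}\<close>;
    then all weights are 0 and any point of \<open>B\<close> refutes the assumption.\<close>
  finally have "2 * \<sigma> * W \<le> W * \<sigma>" using 1 by (rule order_trans)
  then have "W * \<sigma> \<le> 0" by simp
  then have "W = 0" using \<open>W \<ge> 0\<close> \<open>\<sigma> > 0\<close> by (simp add: mult.commute mult_le_0_iff)
  then have "F = {}" using F(1) unfolding W w_def by (simp add: sum_nonneg_eq_0_iff)
  moreover have "B \<noteq> {}" using mB A(2) \<open>v > 0\<close> by auto
  ultimately show False using contra by (auto simp: B_def weight_def)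
qed

section \<open>Well-separated generic sets in the unit ball\<close>

definition admissible :: "real \<Rightarrow> 'a::euclidean_space set \<Rightarrow> bool"
  where "admissible r P \<longleftrightarrow> finite P \<and> P \<subseteq> cball 0 1 \<and> generic P \<and> (\<forall>x\<in>P. \<forall>y\<in>P. x \<noteq> y \<longrightarrow> r \<le> dist x y)"

lemma diam_admissible_le:
  assumes P: "admissible r P" "card P \<ge> 2" and "r > 0"
  shows "diam P \<le> 2 / r"
proof -
  let ?D = "{dist a b | a b. a \<in> P \<and> b \<in> P \<and> a \<noteq> b}"
  have "?D \<subseteq> (\<lambda>(a, b). dist a b) ` (P \<times> P)" by auto
  moreover have "finite P" using P by (simp add: admissible_def)
  ultimately have fin: "finite ?D" by (meson finite_SigmaI finite_imageI finite_subset)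
  have ne: "?D \<noteq> {}"
  proof -
    have "\<not> card P \<le> Suc 0" using P(2) by simp
    then obtain a b where "a \<in> P" "b \<in> P" "a \<noteq> b"
      using card_le_Suc0_iff_eq[OF \<open>finite P\<close>] by blast
    then show ?thesis by blast
  qed
  have up: "x \<le> 2" if x: "x \<in> ?D" for x
  proof -
    obtain a b where ab: "a \<in> P" "b \<in> P" "x = dist a b" using x by blast
    have "norm a \<le> 1" "norm b \<le> 1" using ab P by (auto simp: admissible_def)
    then show ?thesis using norm_triangle_ineq4[of a b] by (simp add: ab(3) dist_norm)
  qed
  have lo: "r \<le> x" if "x \<in> ?D" for x using that P by (auto simp: admissible_def)
  have "Max ?D \<le> 2" using fin ne up by simp
  moreover have "r \<le> Min ?D" using fin ne lo by simp
  ultimately show ?thesis unfolding diam_def using \<open>r > 0\<close> by (intro frac_le) auto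
qed

section \<open>Volumes of balls and of unions of balls\<close>

lemma measure_ball_eq:
  fixes c :: "'a::euclidean_space"
  assumes "r \<ge> 0"
  shows "measure lebesgue (ball c r) = r ^ DIM('a) * measure lebesgue (ball (0::'a) 1)"
  using content_ball_conv_unit_ball[OF assms, of c] by (simp add: measure_completion)

definition unit_vol :: "'a::euclidean_space itself \<Rightarrow> real"
  where "unit_vol _ = measure lebesgue (ball (0::'a) 1)"

lemma measure_ball_unit_vol:
  fixes c :: "'a::euclidean_space"
  assumes "r \<ge> 0"
  shows "measure lebesgue (ball c r) = r ^ DIM('a) * unit_vol TYPE('a)"
    "measure lebesgue (cball c r) = r ^ DIM('a) * unit_vol TYPE('a)"
proof -
  show 1: "measure lebesgue (ball c r) = r ^ DIM('a) * unit_vol TYPE('a)"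
    using measure_ball_eq[OF assms] by (simp add: unit_vol_def)
  have "measure lebesgue (cball c r) = measure lebesgue (ball c r)"
    using emeasure_cball[OF assms, of c] emeasure_ball[OF assms, of c]
    by (simp only: measure_def emeasure_completion) (simp add: measure_def)
  then show "measure lebesgue (cball c r) = r ^ DIM('a) * unit_vol TYPE('a)" using 1 by simp
qed

lemma unit_vol_pos: "unit_vol TYPE('a::euclidean_space) > 0"
  using content_ball_pos[of 1 "0::'a"] by (simp add: unit_vol_def measure_completion)

lemma measure_UN_balls_le:
  fixes P :: "'a::euclidean_space set"
  assumes "finite P" "r \<ge> 0"
  shows "measure lebesgue (\<Union>p\<in>P. ball p r) \<le> real (card P) * (r ^ DIM('a) * unit_vol TYPE('a))"
proof -
  have "measure lebesgue (\<Union>p\<in>P. ball p r) \<le> (\<Sum>p\<in>P. measure lebesgue (ball p r))"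
    using assms by (intro measure_UNION_le) auto
  also have "\<dots> = (\<Sum>p\<in>P. r ^ DIM('a) * unit_vol TYPE('a))"
    by (simp only: measure_ball_unit_vol[OF assms(2)])
  finally show ?thesis by (simp only: sum_constant)
qed

lemma lmeasurable_UN_balls: "finite P \<Longrightarrow> (\<Union>p\<in>P. ball p r) \<in> lmeasurable"
  by (intro fmeasurable.finite_UN) auto

lemma measure_Diff_ge:
  assumes "A \<in> lmeasurable" "B \<in> lmeasurable"
  shows "measure lebesgue (A - B) \<ge> measure lebesgue A - measure lebesgue B"
proof -
  have "measure lebesgue A \<le> measure lebesgue ((A - B) \<union> B)"
    using assms by (intro measure_mono_fmeasurable fmeasurable.Un fmeasurable.Diff) auto
  also have "\<dots> \<le> measure lebesgue (A - B) + measure lebesgue B"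
    using assms by (intro measure_Un_le) auto
  finally show ?thesis by simp
qed

text \<open>The affine hulls of few old points form the exceptional null set of
  \<open>low_weight_point\<close>; avoiding them preserves genericity and makes the point
  new.\<close>

lemma admissible_extend:
  fixes P :: "'a::euclidean_space set"
  assumes F: "finite F" "\<And>S. S \<in> F \<Longrightarrow> S \<in> lmeasurable" "\<And>S. S \<in> F \<Longrightarrow> measure lebesgue S \<le> \<sigma>"
    and \<sigma>: "\<sigma> > 0" and A: "A \<in> lmeasurable" "measure lebesgue A \<ge> v" and v: "v > 0"
    and P: "admissible r P" and sub: "A \<subseteq> cball 0 1" and far: "\<And>x p. x \<in> A \<Longrightarrow> p \<in> P \<Longrightarrow> r \<le> dist x p"
  obtains x where "x \<in> A" "x \<notin> P" "admissible r (insert x P)"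
    "weight F (insert x P) \<le> (1 + 2 * \<sigma> / v) * weight F P"
proof -
  let ?N = "\<Union>T\<in>{T. T \<subseteq> P \<and> card T \<le> DIM('a)}. affine hull T"
  have fin: "finite P" using P by (simp add: admissible_def)
  obtain x where x: "x \<in> A - ?N" "weight F (insert x P) \<le> (1 + 2 * \<sigma> / v) * weight F P"
    using low_weight_point[OF F \<sigma> A v negligible_small_hulls[OF fin] fin] by blast
  have "x \<notin> P" using x(1) subset_small_hulls[of P] by blast
  have "generic (insert x P)" using x(1) P by (intro generic_insert) (auto simp: admissible_def)
  then have "admissible r (insert x P)"
    using P x(1) sub far[of x] unfolding admissible_def by (auto simp: dist_commute)
  then show ?thesis using that x \<open>x \<notin> P\<close> by blast
qed

text \<open>The ball of radius \<open>r/4\<close> about the midpoint lies in both balls, because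
  \<open>5/8 * r + r/4 < r\<close>.\<close>

lemma lens_overlap:
  fixes x p :: "'a::euclidean_space"
  assumes r: "r > 0" and d: "dist x p \<le> 5/4 * r"
  shows "measure lebesgue (ball x r - ball p r) \<le> r ^ DIM('a) * unit_vol TYPE('a) - (r/4) ^ DIM('a) * unit_vol TYPE('a)"
proof -
  define m where "m = midpoint x p"
  have mx: "dist x m = dist x p / 2" "dist p m = dist x p / 2"
    unfolding m_def by (rule dist_midpoint)+
  have sub: "ball m (r/4) \<subseteq> ball x r \<inter> ball p r"
  proof
    fix y assume "y \<in> ball m (r/4)"
    then have "dist m y < r/4" by simp
    then show "y \<in> ball x r \<inter> ball p r"
      using dist_triangle[of x y m] dist_triangle[of p y m] mx d r by simp
  qed
  have "ball x r - ball p r \<subseteq> ball x r - ball m (r/4)" using sub by blast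
  then have "measure lebesgue (ball x r - ball p r) \<le> measure lebesgue (ball x r - ball m (r/4))"
    by (intro measure_mono_fmeasurable fmeasurable.Diff) auto
  also have "\<dots> = measure lebesgue (ball x r) - measure lebesgue (ball m (r/4))"
    using sub by (intro measurable_measure_Diff) auto
  finally show ?thesis using r by (simp only: measure_ball_unit_vol(1)[of r x] measure_ball_unit_vol(1)[of "r/4" m])
qed

text \<open>\<open>\<sigma>\<close> bounds the volume of the sets that are to receive few points;
  \<open>v\<close> is a lower bound for the volume of the region from which each next point is
  drawn.\<close>

locale thin_family =
  fixes F :: "'a::euclidean_space set set" and \<sigma> v :: real
  assumes F: "finite F" "\<And>S. S \<in> F \<Longrightarrow> S \<in> lmeasurable" "\<And>S. S \<in> F \<Longrightarrow> measure lebesgue S \<le> \<sigma>"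
    and \<sigma>: "\<sigma> > 0" and v: "v > 0"
begin

text \<open>The invariant of the selection: the weight starts at \<open>card F\<close> and grows by
  at most the factor of \<open>low_weight_point\<close> with each point.\<close>

definition light :: "'a set \<Rightarrow> bool"
  where "light P \<longleftrightarrow> weight F P \<le> (1 + 2 * \<sigma> / v) ^ card P * real (card F)"

lemma light_extend:
  assumes A: "A \<in> lmeasurable" "measure lebesgue A \<ge> v" "A \<subseteq> cball 0 1"
    and P: "admissible r P" "light P" and far: "\<And>x p. x \<in> A \<Longrightarrow> p \<in> P \<Longrightarrow> r \<le> dist x p"
  obtains x where "x \<in> A" "x \<notin> P" "admissible r (insert x P)" "light (insert x P)"
proof -
  obtain x where x: "x \<in> A" "x \<notin> P" "admissible r (insert x P)"
    "weight F (insert x P) \<le> (1 + 2 * \<sigma> / v) * weight F P"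
    using admissible_extend[OF F \<sigma> A(1,2) v P(1) A(3) far] by blast
  have "finite P" using P(1) by (simp add: admissible_def)
  have "weight F (insert x P) \<le> (1 + 2 * \<sigma> / v) * ((1 + 2 * \<sigma> / v) ^ card P * real (card F))"
    using x(4) P(2) \<sigma> v unfolding light_def
    by (meson add_nonneg_nonneg divide_nonneg_pos less_imp_le mult_left_mono mult_nonneg_nonneg order_trans zero_le_numeral zero_le_one)
  then have "light (insert x P)" using x(2) \<open>finite P\<close> by (simp add: light_def mult.assoc)
  then show ?thesis using that x by blast
qed

lemma admissible_empty: "admissible r {}" "light {}"
  by (auto simp: admissible_def generic_def light_def)

text \<open>Centres are \<open>4 * r\<close> apart so that partners of different centres cannot
  conflict, and \<open>2 * r\<close> away from the unit sphere so that partners stay inside. The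
  volume hypothesis keeps the free region at least \<open>v\<close> even if no two excluded balls
  overlap.\<close>

lemma far_centres:
  assumes r: "r > 0" "2 * r \<le> 1" and m: "v + real m * ((4 * r) ^ DIM('a) * unit_vol TYPE('a)) \<le> (1 - 2 * r) ^ DIM('a) * unit_vol TYPE('a)"
    and k: "k \<le> m"
  shows "\<exists>P. admissible (4 * r) P \<and> light P \<and> card P = k \<and> P \<subseteq> ball 0 (1 - 2 * r)"
  using k
proof (induction k)
  case 0
  then show ?case using admissible_empty by (intro exI[of _ "{}"]) simp
next
  case (Suc k)
  then obtain P where P: "admissible (4 * r) P" "light P" "card P = k" "P \<subseteq> ball 0 (1 - 2 * r)" by auto
  have fin: "finite P" using P(1) by (simp add: admissible_def)
  define A where "A = ball 0 (1 - 2 * r) - (\<Union>p\<in>P. ball p (4 * r))"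
  have "measure lebesgue (\<Union>p\<in>P. ball p (4 * r)) \<le> real k * ((4 * r) ^ DIM('a) * unit_vol TYPE('a))"
    using measure_UN_balls_le[OF fin, of "4 * r"] r P(3) by simp
  also have "\<dots> \<le> real m * ((4 * r) ^ DIM('a) * unit_vol TYPE('a))"
    using Suc.prems r unit_vol_pos[where 'a='a] by (intro mult_right_mono) auto
  finally have "v \<le> measure lebesgue A"
    using measure_Diff_ge[OF lmeasurable_ball lmeasurable_UN_balls[OF fin, of "4 * r"], of 0 "1 - 2 * r"]
      measure_ball_unit_vol(1)[of "1 - 2 * r" "0::'a"] r m unfolding A_def by linarith
  moreover have "A \<in> lmeasurable" unfolding A_def using lmeasurable_UN_balls[OF fin] by (intro fmeasurable.Diff) auto
  moreover have "A \<subseteq> cball 0 1" unfolding A_def using r by auto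
  moreover have "4 * r \<le> dist x p" if "x \<in> A" "p \<in> P" for x p
    using that unfolding A_def by (auto simp: dist_commute not_less)
  ultimately obtain x where "x \<in> A" "x \<notin> P" "admissible (4 * r) (insert x P)" "light (insert x P)"
    using light_extend P(1,2) by metis
  then show ?case using P fin by (intro exI[of _ "insert x P"]) (auto simp: A_def)
qed

text \<open>Placing a partner close to a centre makes the balls of radius \<open>r\<close> overlap. The volume saved in
  this way keeps the uncovered region large until the very last point.\<close>

lemma add_partners:
  assumes r: "r > 0" and C: "admissible (4 * r) C" "light C" "card C = m" "C \<subseteq> ball 0 (1 - 2 * r)"
    and h: "h \<le> m" "v \<le> real (m - h) * ((r/8) ^ DIM('a) * unit_vol TYPE('a))" and t: "t \<le> h"
  shows "\<exists>P. admissible r P \<and> light P \<and> card P = m + t \<and>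
    measure lebesgue (\<Union>p\<in>P. ball p r) \<le> real (card P) * (r ^ DIM('a) * unit_vol TYPE('a)) - real t * ((r/4) ^ DIM('a) * unit_vol TYPE('a))"
proof -
  obtain e :: 'a where e: "e \<in> Basis" using nonempty_Basis by blast
  then have ne: "norm e = 1" by simp
  \<comment> \<open>\<open>9/8 * r\<close> is the middle between \<open>r\<close> and
    \<open>5/4 * r\<close>: a perturbation below \<open>r/8\<close> keeps a partner at an allowed
    distance from its centre and close enough for \<open>lens_overlap\<close>.\<close>
  define s where "s = (9/8 * r) *\<^sub>R e"
  have ns: "norm s = 9/8 * r" using r ne by (simp add: s_def)
  have finC: "finite C" using C by (simp add: admissible_def)
  have d4: "4 * r \<le> dist p q" if "p \<in> C" "q \<in> C" "p \<noteq> q" for p q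
    using that C(1) by (auto simp: admissible_def)
  have near: "r < dist x p \<and> dist x p < 5/4 * r" if "dist (p + s) x < r/8" for x p
  proof -
    have "dist p (p + s) = 9/8 * r" using ns by (simp add: dist_norm)
    then show ?thesis using that dist_triangle[of p "p + s" x] dist_triangle[of p x "p + s"]
      by (simp add: dist_commute)
  qed
  let ?V = "\<lambda>P. measure lebesgue (\<Union>p\<in>P. ball p r)"
  \<comment> \<open>The induction also carries the set \<open>U\<close> of centres that already have
    a partner.\<close>
  have "\<exists>P U. admissible r P \<and> light P \<and> card P = m + t \<and> C \<subseteq> P \<and> U \<subseteq> C \<and> card U = t \<and>
      (\<forall>x\<in>P - C. \<exists>p\<in>U. dist (p + s) x < r/8) \<and>
      ?V P \<le> real (card P) * (r ^ DIM('a) * unit_vol TYPE('a)) - real t * ((r/4) ^ DIM('a) * unit_vol TYPE('a))"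
    using t
  proof (induction t)
    case 0
    have "admissible r C" unfolding admissible_def
    proof (intro conjI ballI impI)
      fix x y assume "x \<in> C" "y \<in> C" "x \<noteq> y"
      then show "r \<le> dist x y" using d4[of x y] r by simp
    qed (use C(1) in \<open>auto simp: admissible_def\<close>)
    then show ?case using C(2,3) measure_UN_balls_le[OF finC, of r] r
      by (intro exI[of _ C] exI[of _ "{}"]) auto
  next
    case (Suc t)
    then obtain P U where P: "admissible r P" "light P" "card P = m + t" "C \<subseteq> P" and U: "U \<subseteq> C" "card U = t"
      and PU: "\<And>x. x \<in> P - C \<Longrightarrow> \<exists>p\<in>U. dist (p + s) x < r/8"
      and V: "?V P \<le> real (card P) * (r ^ DIM('a) * unit_vol TYPE('a)) - real t * ((r/4) ^ DIM('a) * unit_vol TYPE('a))"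
      by auto
    have finP: "finite P" using P(1) by (simp add: admissible_def)
    have finU: "finite U" using U finC finite_subset by blast
    \<comment> \<open>The next partner is drawn near the shifted centres that are still free. More
      than \<open>m - h\<close> of them are left and their small balls are disjoint, which yields
      the volume \<open>v\<close>.\<close>
    define A where "A = (\<Union>p\<in>C - U. ball (p + s) (r/8))"
    have disj: "pairwise (\<lambda>p q. disjnt (ball (p + s) (r/8)) (ball (q + s) (r/8))) (C - U)"
    proof (rule pairwiseI)
      fix p q assume pq: "p \<in> C - U" "q \<in> C - U" "p \<noteq> q"
      have False if "y \<in> ball (p + s) (r/8)" "y \<in> ball (q + s) (r/8)" for y
      proof -
        have "dist (p + s) (q + s) < r/8 + r/8"
          using that dist_triangle2[of "p + s" "q + s" y] by simp
        then show False using d4[of p q] pq r by simp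
      qed
      then show "disjnt (ball (p + s) (r/8)) (ball (q + s) (r/8))" by (auto simp: disjnt_def)
    qed
    have "measure lebesgue A = (\<Sum>p\<in>C - U. measure lebesgue (ball (p + s) (r/8)))"
      unfolding A_def using finC disj by (intro measure_UNION') auto
    also have "\<dots> = (\<Sum>p\<in>C - U. (r/8) ^ DIM('a) * unit_vol TYPE('a))"
      using r by (simp only: measure_ball_unit_vol(1))
    also have "\<dots> = real (m - t) * ((r/8) ^ DIM('a) * unit_vol TYPE('a))"
      using U finU C(3) by (simp add: card_Diff_subset)
    also have "\<dots> \<ge> real (m - h) * ((r/8) ^ DIM('a) * unit_vol TYPE('a))"
      using Suc.prems r unit_vol_pos[where 'a='a] by (intro mult_right_mono) auto
    finally have mA: "v \<le> measure lebesgue A" using h by linarith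
    have "A \<in> lmeasurable" unfolding A_def using finC by (intro fmeasurable.finite_UN) auto
    note Am = this mA
    have Ax: "\<exists>p\<in>C - U. dist (p + s) x < r/8" if "x \<in> A" for x using that by (auto simp: A_def)
    have Ab: "A \<subseteq> cball 0 1"
    proof
      fix x assume "x \<in> A"
      then obtain p where p: "p \<in> C" "dist (p + s) x < r/8" using Ax by blast
      have "norm p < 1 - 2 * r" using p(1) C(4) by auto
      moreover have "dist x p < 5/4 * r" using near[OF p(2)] by simp
      ultimately show "x \<in> cball 0 1"
        using norm_triangle_sub[of x p] r by (simp add: dist_norm)
    qed
    have far: "r \<le> dist x y" if xA: "x \<in> A" and yP: "y \<in> P" for x y
    proof -
      obtain p where p: "p \<in> C - U" "dist (p + s) x < r/8" using Ax[OF xA] by blast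
      note px = near[OF p(2)]
      show ?thesis
      proof (cases "y \<in> C")
        case True
        then show ?thesis
        proof (cases "y = p")
          case False
          then have "4 * r \<le> dist p y" using d4 p(1) True by blast
          then show ?thesis using px dist_triangle2[of p y x] r dist_commute[of x p] dist_commute[of x y] by linarith
        qed (use px in auto)
      next
        case False
        then obtain q where q: "q \<in> U" "dist (q + s) y < r/8" using PU yP by blast
        \<comment> \<open>The two centres are \<open>4 * r\<close> apart and each partner is within
          \<open>5/4 * r\<close> of its own centre, which leaves a distance of at least
          \<open>3/2 * r\<close>.\<close>
        have "4 * r \<le> dist p q" using d4[of p q] p(1) q(1) U(1) by blast
        moreover have "dist p q \<le> dist x p + dist x y + dist y q"
          using dist_triangle[of p q x] dist_triangle[of x q y] dist_commute[of x p] by linarith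
        ultimately show ?thesis using px near[OF q(2)] r by linarith
      qed
    qed
    obtain x where x: "x \<in> A" "x \<notin> P" "admissible r (insert x P)" "light (insert x P)"
      using light_extend[OF Am Ab P(1,2) far] by blast
    obtain p where p: "p \<in> C - U" "dist (p + s) x < r/8" using Ax[OF x(1)] by blast
    \<comment> \<open>Only the part of the new ball outside the ball of its centre is new
      volume.\<close>
    have "?V (insert x P) = measure lebesgue ((\<Union>p\<in>P. ball p r) \<union> (ball x r - ball p r))"
      using p(1) P(4) by (intro arg_cong[where f = "measure lebesgue"]) auto
    also have "\<dots> \<le> ?V P + measure lebesgue (ball x r - ball p r)"
      using lmeasurable_UN_balls[OF finP, of r] by (intro measure_Un_le) (auto intro: fmeasurableD)
    also have "\<dots> \<le> ?V P + (r ^ DIM('a) * unit_vol TYPE('a) - (r/4) ^ DIM('a) * unit_vol TYPE('a))"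
      using lens_overlap[OF r, of x p] near[OF p(2)] by simp
    also have "\<dots> \<le> real (card (insert x P)) * (r ^ DIM('a) * unit_vol TYPE('a)) - real (Suc t) * ((r/4) ^ DIM('a) * unit_vol TYPE('a))"
    proof -
      have "real (card (insert x P)) = real (card P) + 1" "real (Suc t) = real t + 1" using finP x(2) by simp_all
      then show ?thesis using V by (simp only: distrib_right mult_1_left) 
    qed
    finally have "?V (insert x P) \<le> real (card (insert x P)) * (r ^ DIM('a) * unit_vol TYPE('a)) - real (Suc t) * ((r/4) ^ DIM('a) * unit_vol TYPE('a))" .
    moreover have "card (insert p U) = Suc t" using p finU U by simp
    moreover have "\<forall>y\<in>insert x P - C. \<exists>p'\<in>insert p U. dist (p' + s) y < r/8" using PU p(2) by blast
    ultimately show ?case using x P U p finP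
      by (intro exI[of _ "insert x P"] exI[of _ "insert p U"]) auto
  qed
  then show ?thesis by blast
qed

text \<open>Together \<open>n\<close> balls have at most the volume of the unit ball. While fewer
  than \<open>n\<close> points are placed, the uncovered part has at least the volume of one ball
  plus the saving \<open>c\<close>, hence at least \<open>v\<close>.\<close>

lemma fill_up:
  assumes r: "r > 0" and n: "real n * r ^ DIM('a) \<le> 1" and c: "v \<le> r ^ DIM('a) * unit_vol TYPE('a) + c"
    and P0: "admissible r P0" "light P0" "measure lebesgue (\<Union>p\<in>P0. ball p r) \<le> real (card P0) * (r ^ DIM('a) * unit_vol TYPE('a)) - c"
    and "card P0 + k \<le> n"
  shows "\<exists>P. admissible r P \<and> light P \<and> card P = card P0 + k \<and>
    measure lebesgue (\<Union>p\<in>P. ball p r) \<le> real (card P) * (r ^ DIM('a) * unit_vol TYPE('a)) - c"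
  using assms(7)
proof (induction k)
  case 0
  then show ?case using P0 by auto
next
  case (Suc k)
  then obtain P where P: "admissible r P" "light P" "card P = card P0 + k"
    and V: "measure lebesgue (\<Union>p\<in>P. ball p r) \<le> real (card P) * (r ^ DIM('a) * unit_vol TYPE('a)) - c" by auto
  have fin: "finite P" using P(1) by (simp add: admissible_def)
  define A where "A = cball 0 1 - (\<Union>p\<in>P. ball p r)"
  have "real (card P) + 1 \<le> real n" using Suc.prems P(3) by simp
  then have "(real (card P) + 1) * (r ^ DIM('a) * unit_vol TYPE('a)) \<le> real n * (r ^ DIM('a) * unit_vol TYPE('a))"
    using r unit_vol_pos[where 'a='a] by (intro mult_right_mono) auto
  also have "\<dots> \<le> 1 * unit_vol TYPE('a)"
    using n unit_vol_pos[where 'a='a] by (simp only: mult.assoc[symmetric]) (intro mult_right_mono, auto)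
  finally have "(real (card P) + 1) * (r ^ DIM('a) * unit_vol TYPE('a)) \<le> unit_vol TYPE('a)" by simp
  then have "v \<le> measure lebesgue A"
    using measure_Diff_ge[OF lmeasurable_cball lmeasurable_UN_balls[OF fin, of r], of 0 1]
      measure_ball_unit_vol(2)[of 1 "0::'a"] V c unfolding A_def by (simp add: distrib_right)
  moreover have "A \<in> lmeasurable" unfolding A_def using lmeasurable_UN_balls[OF fin] by (intro fmeasurable.Diff) auto
  moreover have "A \<subseteq> cball 0 1" unfolding A_def by auto
  moreover have "r \<le> dist x p" if "x \<in> A" "p \<in> P" for x p
    using that unfolding A_def by (auto simp: dist_commute not_less)
  ultimately obtain x where x: "x \<in> A" "x \<notin> P" "admissible r (insert x P)" "light (insert x P)"
    using light_extend P(1,2) by metis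
  have "measure lebesgue (\<Union>p\<in>insert x P. ball p r) \<le> measure lebesgue (ball x r) + measure lebesgue (\<Union>p\<in>P. ball p r)"
    using lmeasurable_UN_balls[OF fin, of r] unfolding UN_insert by (intro measure_Un_le) (auto intro: fmeasurableD)
  also have "\<dots> \<le> real (card (insert x P)) * (r ^ DIM('a) * unit_vol TYPE('a)) - c"
  proof -
    have "real (card (insert x P)) = real (card P) + 1" using fin x(2) by simp
    then show ?thesis using V measure_ball_unit_vol(1)[of r x] r by (simp only: distrib_right mult_1_left)
  qed
  finally show ?case using x P fin by (intro exI[of _ "insert x P"]) simp
qed

end

section \<open>The construction\<close>

lemma power_inverse_root:
  assumes "n \<ge> 1" "d \<ge> 1"
  shows "(1 / root d (real n)) ^ d = 1 / real n"
  using assms by (simp add: power_divide)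

text \<open>With the empty family, lightness is trivial and \<open>fill_up\<close> is plain greedy
  packing: the volume of one missing ball serves as \<open>v\<close>, and the saving is 0.\<close>

lemma small_packing:
  assumes "n \<ge> 1"
  shows "\<exists>P :: 'a::euclidean_space set. admissible (1 / root DIM('a) (real n)) P \<and> card P = n"
proof -
  let ?r = "1 / root DIM('a) (real n)"
  have r: "?r > 0" "real n * ?r ^ DIM('a) \<le> 1" using assms by (auto simp: power_inverse_root Suc_leI)
  interpret thin_family "{} :: 'a set set" 1 "?r ^ DIM('a) * unit_vol TYPE('a)"
    using r unit_vol_pos[where 'a='a] by unfold_locales auto
  show ?thesis
    using fill_up[OF r(1) r(2), of 0 "{}" n] admissible_empty by auto
qed

text \<open>Three stages: far centres, partners for about half of them, then filling up. The first
  threshold for \<open>n\<close> makes the radius small compared with \<open>1 / DIM('a)\<close>,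
  the second yields at least two centres.\<close>

lemma light_packing:
  defines "v \<equiv> unit_vol TYPE('a::euclidean_space) / (16 * 32 ^ DIM('a))"
  assumes n: "n \<ge> (4 * DIM('a)) ^ DIM('a)" "n \<ge> 2 * 4 ^ (DIM('a) + 1)"
    and F: "finite F" "\<And>S :: 'a set. S \<in> F \<Longrightarrow> S \<in> lmeasurable" "\<And>S. S \<in> F \<Longrightarrow> measure lebesgue S \<le> \<sigma>" "\<sigma> > 0"
  shows "\<exists>P. admissible (1 / root DIM('a) (real n)) P \<and> card P = n \<and>
    weight F P \<le> (1 + 2 * \<sigma> / v) ^ n * real (card F)"
proof -
  define d where "d = DIM('a)"
  define r where "r = 1 / root d (real n)"
  define w where "w = unit_vol TYPE('a)"
  have w: "w > 0" using unit_vol_pos by (simp add: w_def)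
  have d: "d \<ge> 1" by (simp add: d_def Suc_leI)
  have n1: "n \<ge> 1" 
  proof -
    have "(1::nat) \<le> 2 * 4 ^ (DIM('a) + 1)" by simp
    then show ?thesis using n(2) by (rule order_trans)
  qed
  have r0: "r > 0" using n1 d by (simp add: r_def)
  have rd: "r ^ d = 1 / real n" unfolding r_def by (rule power_inverse_root[OF n1 d])
  have v_def': "v = w / (16 * 32 ^ d)" by (simp add: v_def w_def d_def)
  have v0: "v > 0" using w by (simp add: v_def')
  interpret thin_family F \<sigma> v using F v0 by unfold_locales auto
  have r4: "4 * real d * r \<le> 1"
  proof -
    have "(4 * real d) ^ d \<le> real n" using of_nat_mono[OF n(1), where 'a=real] by (simp add: d_def)
    then have "root d ((4 * real d) ^ d) \<le> root d (real n)" using d by (intro real_root_le_mono) auto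
    moreover have "root d ((4 * real d) ^ d) = 4 * real d" using d by (intro real_root_power_cancel) auto
    ultimately have "4 * real d \<le> root d (real n)" by simp
    then show ?thesis using n1 d by (simp add: r_def divide_le_eq)
  qed
  have "4 * 1 * r \<le> 4 * real d * r" using d r0 by (intro mult_right_mono mult_left_mono) auto
  then have r2: "2 * r \<le> 1" using r4 r0 by linarith
  \<comment> \<open>By Bernoulli's inequality, shrinking the radius by \<open>2 * r\<close> keeps
    half of the volume of the unit ball.\<close>
  have half: "(1 - 2 * r) ^ d \<ge> 1/2"
  proof -
    have "1 + real d * (- 2 * r) \<le> (1 + (- 2 * r)) ^ d" using r2 by (intro Bernoulli_inequality) auto
    then show ?thesis using r4 by (simp add: algebra_simps)
  qed
  \<comment> \<open>With about \<open>n / 4 ^ (d + 1)\<close> centres, the excluded balls of radius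
    \<open>4 * r\<close> take at most a quarter of the unit volume.\<close>
  define N where "N = (4::nat) ^ (d + 1)"
  have N: "N \<ge> 1" "real N = 4 * 4 ^ d" by (auto simp: N_def)
  define m where "m = n div N"
  have m2: "m \<ge> 2" unfolding m_def using n(2) N(1) by (simp add: less_eq_div_iff_mult_less_eq N_def d_def)
  have m_up: "real m * real N \<le> real n" 
    unfolding m_def by (metis div_times_less_eq_dividend of_nat_le_iff of_nat_mult)
  have m_lo: "real n \<le> 2 * real m * real N"
  proof -
    have "n mod N < N" using N(1) by simp
    moreover have "m * N + n mod N = n" by (simp add: m_def)
    moreover have "N \<le> m * N" using m2 by simp
    ultimately have "n \<le> 2 * m * N" by linarith
    then show ?thesis by (metis of_nat_le_iff of_nat_mult of_nat_numeral)
  qed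
  \<comment> \<open>At least half of the centres stay without a partner and leave room for drawing
    the last one, while the number of partners remains proportional to \<open>n\<close> and so does
    the number of overlaps.\<close>
  define h where "h = m div 2"
  have h: "h \<le> m" "real m \<le> 2 * real (m - h)" "real m \<le> 4 * real h"
    using m2 by (auto simp: h_def)
  have np: "real n > 0" using n1 by simp
  have p32: "(32::real) ^ d = 4 ^ d * 8 ^ d" by (simp add: power_mult_distrib[symmetric])
  have vN: "v * (16 * (4 ^ d * 8 ^ d)) = w" by (simp add: v_def' p32)
  have k1: "v + real m * ((4 * r) ^ d * w) \<le> (1 - 2 * r) ^ d * w"
  proof -
    have "v \<le> w / 4"
    proof -
      have "(1::real) \<le> 32 ^ d" by simp
      then have "4 \<le> 16 * (32::real) ^ d" by linarith
      then show ?thesis unfolding v_def' using w by (intro divide_left_mono) auto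
    qed
    moreover have "real m * ((4 * r) ^ d * w) \<le> w / 4"
    proof -
      have "real m * (4 * r) ^ d \<le> 1 / 4"
        using m_up np by (simp add: power_mult_distrib rd N field_simps)
      then have "real m * (4 * r) ^ d * w \<le> 1 / 4 * w" using w by (intro mult_right_mono) auto
      then show ?thesis by (simp add: mult.assoc)
    qed
    moreover have "1/2 * w \<le> (1 - 2 * r) ^ d * w" using half w by (intro mult_right_mono) auto
    ultimately show ?thesis by linarith
  qed
  obtain C where C: "admissible (4 * r) C" "light C" "card C = m" "C \<subseteq> ball 0 (1 - 2 * r)"
    using far_centres[OF r0 r2, of m m] k1 by (auto simp: d_def w_def)
  have lo: "real n / (8 * 4 ^ d) \<le> real m" using m_lo N by (simp add: field_simps)
  have k2: "v \<le> real (m - h) * ((r/8) ^ d * w)"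
  proof -
    \<comment> \<open>The origin of the constant in \<open>v\<close>: at least
      \<open>n / (8 * 4 ^ d)\<close> centres, at least half of them free, each offering a ball of
      radius \<open>r/8\<close>.\<close>
    have "v = (real n / (8 * 4 ^ d)) / 2 * (w / (real n * 8 ^ d))"
      using np by (simp add: v_def' p32)
    also have "\<dots> \<le> real (m - h) * (w / (real n * 8 ^ d))"
      using lo h(2) w by (intro mult_right_mono) auto
    also have "\<dots> = real (m - h) * ((r/8) ^ d * w)" by (simp add: power_divide rd)
    finally show ?thesis .
  qed
  obtain P0 where P0: "admissible r P0" "light P0" "card P0 = m + h"
    "measure lebesgue (\<Union>p\<in>P0. ball p r) \<le> real (card P0) * (r ^ DIM('a) * unit_vol TYPE('a)) - real h * ((r/4) ^ DIM('a) * unit_vol TYPE('a))"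
    using add_partners[OF r0 C h(1) k2[unfolded d_def w_def], of h] by auto
  have k3: "v \<le> r ^ DIM('a) * unit_vol TYPE('a) + real h * ((r/4) ^ DIM('a) * unit_vol TYPE('a))"
  proof -
    have "(2::real) * 4 ^ d \<le> 8 ^ d"
    proof -
      have "(2::real) ^ 1 \<le> 2 ^ d" using d by (intro power_increasing) auto
      then have "(2::real) * 4 ^ d \<le> 2 ^ d * 4 ^ d" by (intro mult_right_mono) auto
      then show ?thesis by (simp add: power_mult_distrib[symmetric])
    qed
    then have "w / (16 * (4 ^ d * 8 ^ d)) \<le> w / (16 * (4 ^ d * (2 * 4 ^ d)))"
      using w by (intro divide_left_mono) auto
    then have "v \<le> (real n / (8 * 4 ^ d)) / 4 * (w / (real n * 4 ^ d))"
      using np by (simp add: v_def' p32)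
    also have "\<dots> \<le> real h * (w / (real n * 4 ^ d))"
      using lo h(3) w by (intro mult_right_mono) auto
    also have "\<dots> = real h * ((r/4) ^ d * w)" by (simp add: power_divide rd)
    finally have "v \<le> real h * ((r/4) ^ d * w)" .
    moreover have "0 \<le> r ^ d * w" using r0 w by simp
    ultimately show ?thesis by (simp add: d_def w_def)
  qed
  have mh: "m + h \<le> n"
  proof -
    have "2 * m \<le> N * m" using N_def by (intro mult_right_mono) auto
    also have "\<dots> \<le> n" by (simp add: m_def)
    finally show ?thesis using h(1) by linarith
  qed
  have rn: "real n * r ^ DIM('a) \<le> 1" using rd np by (simp add: d_def)
  obtain P where "admissible r P" "light P" "card P = n"
    using fill_up[OF r0 rn k3 P0(1,2,4), of "n - (m + h)"] P0(3) mh by auto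
  then show ?thesis by (auto simp: light_def r_def d_def)
qed

theorem theorem2:
  assumes "CARD('d::finite) \<ge> 2"
  shows "\<exists>\<gamma>::real. \<gamma> > 0 \<and>
    (\<forall>n::nat. n \<ge> 1 \<longrightarrow>
      (\<exists>P :: (real ^ 'd) set.
         finite P \<and> card P = n \<and> general_position P \<and>
         (n \<ge> 2 \<longrightarrow> diam P \<le> 2 * root CARD('d) (real n)) \<and>
         \<not> (\<exists>Q. Q \<subseteq> P \<and> convex_independent Q \<and>
               real (card Q) \<ge> \<gamma> * real n powr ((real CARD('d) - 1) / (real CARD('d) + 1)))))"
proof -
  define d where "d = CARD('d)"
  have d: "d \<ge> 2" using assms by (simp add: d_def)
  have dim: "DIM(real ^ 'd) = d" by (simp add: d_def)
  define v where "v = unit_vol TYPE(real ^ 'd) / (16 * 32 ^ d)"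
  have v: "v > 0" using unit_vol_pos[where 'a="real ^ 'd"] by (simp add: v_def)
  define \<alpha> where "\<alpha> = (real d - 1) / (real d + 1)"
  have \<alpha>: "\<alpha> \<ge> 0" using d by (simp add: \<alpha>_def)
  obtain C where C: "C > 0" and shells: "\<And>M. M \<ge> 1 \<Longrightarrow> \<exists>F :: (real ^ 'd) set set. shell_cover C M F"
    using shells_cover_convex_independent[OF assms] by blast
  \<comment> \<open>The two thresholds of \<open>light_packing\<close>.\<close>
  define n0 where "n0 = max ((4 * d) ^ d) (2 * 4 ^ (d + 1))"
  \<comment> \<open>The outer factor 2 undoes the halving in \<open>exp (card / 2)\<close>;
    \<open>2 / v\<close> comes from the volume of the shells, and \<open>2 ^ (d - 1)\<close> from
    their number, by way of \<open>M \<le> 2 * x\<close>.\<close>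
  define B where "B = 2 * C * (2 / v + 2 ^ (d - 1))"
  \<comment> \<open>A convex independent set meets at most \<open>2 * d\<close> shells of its cover,
    each bounded through \<open>B\<close>. The term \<open>n0\<close> settles all
    \<open>n < n0\<close>, where already \<open>card Q \<le> n < \<gamma>\<close>; the 1 makes the
    comparisons strict.\<close>
  define \<gamma> where "\<gamma> = 2 * real d * B + real n0 + 1"
  have B: "B > 0" using C v by (simp add: B_def add_pos_pos)
  have \<gamma>: "\<gamma> > 0" "\<gamma> > real n0" "\<gamma> > 2 * real d * B" using B by (auto simp: \<gamma>_def add_nonneg_pos)
  show ?thesis
  proof (intro exI[of _ \<gamma>] conjI allI impI \<gamma>(1))
    fix n :: nat assume n: "n \<ge> 1"
    have n\<alpha>: "real n powr \<alpha> \<ge> 1" using n \<alpha> by (simp add: ge_one_powr_ge_zero)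
    let ?r = "1 / root d (real n)"
    have r: "?r > 0" using n d by simp
    have "\<exists>P :: (real ^ 'd) set. admissible ?r P \<and> card P = n \<and>
      (\<forall>Q. Q \<subseteq> P \<and> convex_independent Q \<longrightarrow> real (card Q) < \<gamma> * real n powr \<alpha>)"
    proof (cases "n \<ge> n0")
      case False
      obtain P :: "(real ^ 'd) set" where P: "admissible ?r P" "card P = n"
        using small_packing[OF n, where 'a="real ^ 'd"] unfolding dim by blast
      have "real (card Q) < \<gamma> * real n powr \<alpha>" if "Q \<subseteq> P" for Q
      proof -
        have "card Q \<le> n" using card_mono[OF _ that] P by (simp add: admissible_def)
        then have "real (card Q) < \<gamma>" using False \<gamma>(2) by linarith
        also have "\<gamma> * 1 \<le> \<gamma> * real n powr \<alpha>" using n\<alpha> \<gamma>(1) by (intro mult_left_mono) auto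
        finally show ?thesis by simp
      qed
      then show ?thesis using P by blast
    next
      case True
      \<comment> \<open>This order of magnitude for \<open>M\<close> balances the two exponents:
        \<open>n / M ^ 2\<close> from the volume of the shells and \<open>M ^ (d - 1)\<close> from
        their number. Both become \<open>n powr \<alpha>\<close>.\<close>
      define x where "x = real n powr (1 / (real d + 1))"
      have x1: "x \<ge> 1" using n unfolding x_def by (intro ge_one_powr_ge_zero) auto
      have xpow: "x ^ k = real n powr (real k / (real d + 1))" for k
        using n by (simp add: x_def powr_realpow[symmetric] powr_powr)
      have xd: "x ^ (d - 1) = real n powr \<alpha>" using d by (simp add: xpow \<alpha>_def of_nat_diff)
      have xn: "real n = x ^ 2 * x ^ (d - 1)"
      proof -
        have "x ^ 2 * x ^ (d - 1) = x ^ (d + 1)" using d by (simp add: power_add[symmetric])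
        also have "\<dots> = real n" using n by (simp add: xpow add.commute del: power_Suc)
        finally show ?thesis ..
      qed
      \<comment> \<open>Both directions matter: \<open>M \<ge> x\<close> keeps the shells thin, and
        \<open>M \<le> 2 * x\<close> keeps them few.\<close>
      define M where "M = nat \<lceil>x\<rceil>"
      have M: "M \<ge> 1" "x \<le> real M" "real M \<le> 2 * x" using x1 unfolding M_def by linarith+
      obtain F :: "(real ^ 'd) set set" where F: "finite F" "real (card F) \<le> exp (C * real M ^ (d - 1))"
        "\<And>S. S \<in> F \<Longrightarrow> S \<in> lmeasurable" "\<And>S. S \<in> F \<Longrightarrow> measure lebesgue S \<le> C / real M ^ 2"
        and cover: "\<And>Q. finite Q \<Longrightarrow> Q \<subseteq> cball 0 1 \<Longrightarrow> convex_independent Q \<Longrightarrow> \<exists>G\<subseteq>F. card G \<le> 2 * d \<and> Q \<subseteq> \<Union>G"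
      proof -
        obtain F :: "(real ^ 'd) set set" where F: "shell_cover C M F" using shells[OF M(1)] by blast
        show ?thesis using F that[of F] unfolding shell_cover_def d_def by simp
      qed
      define \<sigma> where "\<sigma> = C / real M ^ 2"
      have \<sigma>: "\<sigma> > 0" using C M by (simp add: \<sigma>_def)
      obtain P where P: "admissible ?r P" "card P = n" "weight F P \<le> (1 + 2 * \<sigma> / v) ^ n * real (card F)"
        using light_packing[where 'a="real ^ 'd", of n F \<sigma>] True F \<sigma>
        unfolding dim n0_def v_def \<sigma>_def by auto
      have finP: "finite P" "P \<subseteq> cball 0 1" using P(1) by (auto simp: admissible_def)
      have few: "real (card (P \<inter> S)) \<le> B * real n powr \<alpha>" if S: "S \<in> F" for S
      proof -
        \<comment> \<open>Since \<open>ln 2 \<ge> 1/2\<close>, the weight is at least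
          \<open>exp (card (P \<inter> S) / 2)\<close>, and the upper bound on the weight can be
          compared exponent by exponent.\<close>
        have "real (card (P \<inter> S)) / 2 \<le> real (card (P \<inter> S)) * ln 2"
          using ln2_ge_two_thirds mult_left_mono[of "1/2" "ln 2" "real (card (P \<inter> S))"] by simp
        then have "exp (real (card (P \<inter> S)) / 2) \<le> exp (real (card (P \<inter> S)) * ln 2)" by simp
        also have "\<dots> = 2 ^ card (P \<inter> S)" by (simp add: exp_of_nat_mult)
        also have "\<dots> \<le> weight F P"
          unfolding weight_def using S F(1) by (intro member_le_sum[of S F "\<lambda>S. 2 ^ card (P \<inter> S)"]) auto
        also have "\<dots> \<le> (1 + 2 * \<sigma> / v) ^ n * real (card F)" by (rule P(3))
        also have "\<dots> \<le> exp (2 * \<sigma> / v) ^ n * exp (C * real M ^ (d - 1))"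
          using \<sigma> v F(2) exp_ge_add_one_self[of "2 * \<sigma> / v"] by (intro mult_mono power_mono) auto
        also have "\<dots> = exp (real n * (2 * \<sigma> / v) + C * real M ^ (d - 1))"
          by (simp only: exp_add exp_of_nat_mult)
        finally have "real (card (P \<inter> S)) / 2 \<le> real n * (2 * \<sigma> / v) + C * real M ^ (d - 1)" by simp
        also have "real n * (2 * \<sigma> / v) \<le> 2 * C / v * x ^ (d - 1)"
        proof -
          have "\<sigma> \<le> C / x ^ 2" unfolding \<sigma>_def using C x1 M by (intro divide_left_mono power_mono) auto
          then have "real n * (2 * \<sigma> / v) \<le> real n * (2 * (C / x ^ 2) / v)"
            using v by (intro mult_left_mono divide_right_mono) auto
          also have "\<dots> = 2 * C / v * x ^ (d - 1)" unfolding xn using x1 by simp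
          finally show ?thesis .
        qed
        also have "C * real M ^ (d - 1) \<le> C * (2 ^ (d - 1) * x ^ (d - 1))"
          unfolding power_mult_distrib[symmetric] using C M by (intro mult_left_mono power_mono) auto
        finally have "real (card (P \<inter> S)) \<le> 2 * (2 * C / v * x ^ (d - 1) + C * (2 ^ (d - 1) * x ^ (d - 1)))"
          by simp
        also have "\<dots> = B * x ^ (d - 1)" by (simp add: B_def algebra_simps)
        finally show ?thesis by (simp only: xd)
      qed
      have "real (card Q) < \<gamma> * real n powr \<alpha>" if Q: "Q \<subseteq> P" "convex_independent Q" for Q
      proof -
        have finQ: "finite Q" using Q(1) finP(1) finite_subset by blast
        obtain G where G: "G \<subseteq> F" "card G \<le> 2 * d" "Q \<subseteq> \<Union>G"
          using cover[OF finQ _ Q(2)] Q(1) finP(2) by blast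
        have finG: "finite G" using G(1) F(1) finite_subset by blast
        have "card Q \<le> card (\<Union>S\<in>G. P \<inter> S)" using Q(1) G(3) finG finP(1) by (intro card_mono) auto
        also have "\<dots> \<le> (\<Sum>S\<in>G. card (P \<inter> S))" by (rule card_UN_le[OF finG])
        finally have "real (card Q) \<le> (\<Sum>S\<in>G. real (card (P \<inter> S)))" by (simp flip: of_nat_sum)
        also have "\<dots> \<le> (\<Sum>S\<in>G. B * real n powr \<alpha>)" using few G(1) by (intro sum_mono) blast
        also have "\<dots> = real (card G) * (B * real n powr \<alpha>)" by simp
        also have "\<dots> \<le> real (2 * d) * (B * real n powr \<alpha>)"
          using B of_nat_mono[OF G(2), where 'a=real] by (intro mult_right_mono) auto
        also have "\<dots> = (2 * real d * B) * real n powr \<alpha>" by simp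
        also have "\<dots> < \<gamma> * real n powr \<alpha>" using \<gamma>(3) n\<alpha> n by (intro mult_strict_right_mono) auto
        finally show ?thesis .
      qed
      then show ?thesis using P by blast
    qed
    then obtain P :: "(real ^ 'd) set" where P: "admissible ?r P" "card P = n"
      "\<And>Q. Q \<subseteq> P \<Longrightarrow> convex_independent Q \<Longrightarrow> real (card Q) < \<gamma> * real n powr \<alpha>" by blast
    show "\<exists>P :: (real ^ 'd) set. finite P \<and> card P = n \<and> general_position P \<and>
         (n \<ge> 2 \<longrightarrow> diam P \<le> 2 * root CARD('d) (real n)) \<and>
         \<not> (\<exists>Q. Q \<subseteq> P \<and> convex_independent Q \<and>
               real (card Q) \<ge> \<gamma> * real n powr ((real CARD('d) - 1) / (real CARD('d) + 1)))"
    proof (rule exI[of _ P], intro conjI impI notI)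
      show "finite P" "general_position P"
        using P(1) by (auto simp: admissible_def intro: generic_imp_general_position)
      show "card P = n" by (rule P(2))
      show "diam P \<le> 2 * root CARD('d) (real n)" if "n \<ge> 2"
        using diam_admissible_le[OF P(1) _ r] P(2) that by (simp add: d_def)
      assume "\<exists>Q. Q \<subseteq> P \<and> convex_independent Q \<and>
        real (card Q) \<ge> \<gamma> * real n powr ((real CARD('d) - 1) / (real CARD('d) + 1))"
      then show False using P(3) unfolding \<alpha>_def d_def by (meson not_less)
    qed
  qed
qed

end
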